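(* Let $\mathbb{F}$ be an ordered field, let $n\ge3$, and let $\mathcal{L}=\{L_1,\ldots,L_n\}$ be a line arrangement in $\mathbb{F}^2$ which gives rise to a (bounded) $n$-gonality in the anticlockwise cyclic order $L_1\to L_2\to\cdots\to L_n\to L_1$; indices are taken modulo $n$. Let $k$ be the number of indices $i$ such that the intersection points $L_j\cap L_{j+1}$, $j\notin\{i-1,i\}$, all lie in one open half-plane bounded by $L_i$ and the point $L_{i-1}\cap L_{i+1}$ lies in the other open half-plane bounded by $L_i$. Then among the bounded regions of the arrangement there are exactly $k$ triangular regions, exactly one bounded $n$-gon, and exactly $\binom{n-1}{2}-k-1$ quadrilaterals.
   Context: An ordered field is a totally ordered field with $x\le y\Rightarrow x+z\le y+z$ and $x,y\ge0\Rightarrow xy\ge0$. A line arrangement is a finite set of lines in $\mathbb{F}^2$ with no two parallel and no three concurrent. If $L_i$ has equation $a_ix+b_iy=c_i$, a region is a set $\{(x,y):\varepsilon_i(a_ix+b_iy-c_i)\ge0\ \forall i\}$ (for some signs $\varepsilon_i$) containing a point where all inequalities are strict; it is bounded if it contains no ray $\{v+tw:t\ge0\}$, $w\ne0$. A bounded region is an $m$-gon (triangle for $m=3$, quadrilateral for $m=4$) if exactly $m$ lines meet it, each in a segment between adjacent intersection points. An $n$-gonality with anticlockwise order $L_1\to\cdots\to L_n\to L_1$ is a bounded region met by every $L_i$ in a segment between adjacent intersection points, whose sides occur in the order $L_1,\ldots,L_n$ when its boundary is traversed anticlockwise.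
   Formalization: The triangles and quadrilaterals are counted without the given n-gonality itself; read literally the counts fail for n = 3 (k = 0 but the 3-gonality is a triangle) and n = 4 (count 0 but the 4-gonality is a quadrilateral). For n ≥ 5 nothing changes. *)

theory Defs
  imports Complex_Main
begin

type_synonym 'a pt = "'a \<times> 'a"

definition has_equation :: "('a::linordered_field) pt set \<Rightarrow> 'a \<Rightarrow> 'a \<Rightarrow> 'a \<Rightarrow> bool" where
  "has_equation L a b c \<longleftrightarrow> (a \<noteq> 0 \<or> b \<noteq> 0) \<and> L = {(x, y). a * x + b * y = c}"

definition is_line :: "('a::linordered_field) pt set \<Rightarrow> bool" where
  "is_line L \<longleftrightarrow> (\<exists>a b c. has_equation L a b c)"

text \<open>Two distinct lines of the plane are parallel iff they are disjoint.\<close>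

definition line_arrangement :: "('a::linordered_field) pt set set \<Rightarrow> bool" where
  "line_arrangement A \<longleftrightarrow> finite A \<and> (\<forall>L\<in>A. is_line L)
     \<and> (\<forall>L\<in>A. \<forall>M\<in>A. L \<noteq> M \<longrightarrow> L \<inter> M \<noteq> {})
     \<and> (\<forall>L\<in>A. \<forall>M\<in>A. \<forall>N\<in>A. L \<noteq> M \<and> L \<noteq> N \<and> M \<noteq> N \<longrightarrow> L \<inter> M \<inter> N = {})"

text \<open>The equation of a line is unique only up to a nonzero factor. Together with the signs
  \<open>\<epsilon>\<close>, the existential choice of equations below yields the same sets as any fixed choice.\<close>

definition is_region :: "('a::linordered_field) pt set set \<Rightarrow> 'a pt set \<Rightarrow> bool" where
  "is_region A R \<longleftrightarrow> (\<exists>a b c \<epsilon>.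
     (\<forall>L\<in>A. has_equation L (a L) (b L) (c L) \<and> \<epsilon> L \<in> {1, -1}) \<and>
     R = {(x, y). \<forall>L\<in>A. \<epsilon> L * (a L * x + b L * y - c L) \<ge> 0} \<and>
     (\<exists>x y. \<forall>L\<in>A. \<epsilon> L * (a L * x + b L * y - c L) > 0))"

definition bounded_set :: "('a::linordered_field) pt set \<Rightarrow> bool" where
  "bounded_set R \<longleftrightarrow>
     \<not> (\<exists>v w. w \<noteq> (0, 0) \<and> {(fst v + t * fst w, snd v + t * snd w) | t. t \<ge> 0} \<subseteq> R)"

definition bounded_regions :: "('a::linordered_field) pt set set \<Rightarrow> 'a pt set set" where
  "bounded_regions A = {R. is_region A R \<and> bounded_set R}"

definition segment :: "('a::linordered_field) pt \<Rightarrow> 'a pt \<Rightarrow> 'a pt set" where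
  "segment p q = {((1 - t) * fst p + t * fst q, (1 - t) * snd p + t * snd q) | t. 0 \<le> t \<and> t \<le> 1}"

definition intersection_points :: "('a::linordered_field) pt set set \<Rightarrow> 'a pt set" where
  "intersection_points A = {p. \<exists>L\<in>A. \<exists>M\<in>A. L \<noteq> M \<and> p \<in> L \<and> p \<in> M}"

definition adjacent :: "('a::linordered_field) pt set set \<Rightarrow> 'a pt set \<Rightarrow> 'a pt \<Rightarrow> 'a pt \<Rightarrow> bool" where
  "adjacent A L p q \<longleftrightarrow> p \<in> L \<and> q \<in> L \<and> p \<noteq> q \<and> segment p q \<inter> intersection_points A = {p, q}"

definition meets_in_side :: "('a::linordered_field) pt set set \<Rightarrow> 'a pt set \<Rightarrow> 'a pt set \<Rightarrow> bool" where
  "meets_in_side A L R \<longleftrightarrow> (\<exists>p q. adjacent A L p q \<and> L \<inter> R = segment p q)"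

definition gons :: "('a::linordered_field) pt set set \<Rightarrow> nat \<Rightarrow> 'a pt set set" where
  "gons A m = {R \<in> bounded_regions A. card {L\<in>A. L \<inter> R \<noteq> {}} = m
     \<and> (\<forall>L\<in>A. L \<inter> R \<noteq> {} \<longrightarrow> meets_in_side A L R)}"

text \<open>The numbers of triangles, \<open>n\<close>-gons and quadrilaterals in the theorem add up to the number
  \<open>(n - 1) choose 2\<close> of all bounded regions, so the \<open>n\<close>-gon is not counted again as a triangle
  (\<open>n = 3\<close>) or quadrilateral (\<open>n = 4\<close>). For \<open>n \<ge> 5\<close> it is neither, so that removing it from
  \<open>gons A 3\<close> and \<open>gons A 4\<close> has no effect.\<close>

definition weakly_left_of :: "('a::linordered_field) pt \<Rightarrow> 'a pt \<Rightarrow> 'a pt \<Rightarrow> bool" where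
  "weakly_left_of s t p \<longleftrightarrow>
     (fst t - fst s) * (snd p - snd s) - (snd t - snd s) * (fst p - fst s) \<ge> 0"

text \<open>The lines are \<open>L 0, \<dots>, L (n - 1)\<close>, with indices read modulo \<open>n\<close>. An anticlockwise
  traversal of the boundary of \<open>P\<close> in the order \<open>L 0, \<dots>, L (n - 1)\<close> is recorded by the
  points \<open>v i\<close> at which it enters the side on \<open>L i\<close>: that side is traversed from \<open>v i\<close>
  to \<open>v (i + 1)\<close>, with \<open>P\<close> on the left.\<close>

definition gonality :: "nat \<Rightarrow> (nat \<Rightarrow> ('a::linordered_field) pt set) \<Rightarrow> 'a pt set \<Rightarrow> bool" where
  "gonality n L P \<longleftrightarrow> P \<in> bounded_regions (L ` {..<n})
     \<and> (\<forall>i<n. meets_in_side (L ` {..<n}) (L i) P)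
     \<and> (\<exists>v. \<forall>i<n. v i \<noteq> v ((i + 1) mod n)
              \<and> L i \<inter> P = segment (v i) (v ((i + 1) mod n))
              \<and> (\<forall>p\<in>P. weakly_left_of (v i) (v ((i + 1) mod n)) p))"

definition meet :: "('a::linordered_field) pt set \<Rightarrow> 'a pt set \<Rightarrow> 'a pt" where
  "meet L M = (THE p. p \<in> L \<and> p \<in> M)"

text \<open>For a line \<open>L\<close> this set has exactly two elements: negating an equation of \<open>L\<close>
  exchanges the two sides.\<close>

definition open_half_planes :: "('a::linordered_field) pt set \<Rightarrow> 'a pt set set" where
  "open_half_planes L = {{(x, y). a * x + b * y > c} | a b c. has_equation L a b c}"

text \<open>In terms of residues modulo \<open>n\<close>, the index \<open>i - 1\<close> is \<open>(i + n - 1) mod n\<close>.\<close>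

definition separating_index :: "nat \<Rightarrow> (nat \<Rightarrow> ('a::linordered_field) pt set) \<Rightarrow> nat \<Rightarrow> bool" where
  "separating_index n L i \<longleftrightarrow> (\<exists>H\<in>open_half_planes (L i). \<exists>H'\<in>open_half_planes (L i). H \<noteq> H'
     \<and> (\<forall>j<n. j \<notin> {(i + n - 1) mod n, i} \<longrightarrow> meet (L j) (L ((j + 1) mod n)) \<in> H)
     \<and> meet (L ((i + n - 1) mod n)) (L ((i + 1) mod n)) \<in> H')"

text \<open>An arrangement has finitely many regions, so \<open>card\<close> of a set of regions really counts.\<close>

lemma has_equation_proportional:
  assumes "has_equation L a b c" "has_equation L a' b' c'"
  obtains s where "s \<noteq> 0" "a' = s * a" "b' = s * b" "c' = s * c"
proof -
  define d where "d = a * a + b * b"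
  have ab: "a \<noteq> 0 \<or> b \<noteq> 0" and ab': "a' \<noteq> 0 \<or> b' \<noteq> 0"
    using assms by (auto simp: has_equation_def)
  have d: "d \<noteq> 0"
    using ab by (simp add: d_def sum_squares_eq_zero_iff)
  have eq: "a * x + b * y = c \<longleftrightarrow> a' * x + b' * y = c'" for x y
    using assms by (auto simp: has_equation_def set_eq_iff)
  have on: "a * (a * c / d) + b * (b * c / d) = c"
  proof -
    have "a * (a * c / d) + b * (b * c / d) = d * c / d"
      by (simp add: d_def add_divide_distrib algebra_simps)
    then show ?thesis
      using d by simp
  qed
  have "a * (a * c / d - b) + b * (b * c / d + a) = c"
    using on by (simp add: algebra_simps)
  then have "a' * (a * c / d - b) + b' * (b * c / d + a) = c'"
    using eq by blast
  moreover have c': "a' * (a * c / d) + b' * (b * c / d) = c'"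
    using on eq by blast
  ultimately have par: "a' * b = b' * a"
    by (simp add: algebra_simps)
  define s where "s = (a' * a + b' * b) / d"
  have a's: "a' = s * a"
  proof -
    have "a' * d = (a' * a + b' * b) * a"
      using par by (simp add: d_def algebra_simps)
    then show ?thesis
      using d by (simp add: s_def field_simps)
  qed
  have b's: "b' = s * b"
  proof -
    have "b' * d = (a' * a + b' * b) * b"
      using par by (simp add: d_def algebra_simps)
    then show ?thesis
      using d by (simp add: s_def field_simps)
  qed
  have "c' = s * (a * (a * c / d) + b * (b * c / d))"
    using c' by (simp add: a's b's algebra_simps)
  then have "c' = s * c"
    using on by simp
  moreover have "s \<noteq> 0"
    using ab' a's b's by auto
  ultimately show thesis
    using that a's b's by blast
qed

lemma finite_regions:
  assumes "finite A"
  shows "finite {R. is_region A R}"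
proof -
  define C where "C L = {{(x, y). e * (a * x + b * y - c) \<ge> 0} | e a b c.
    has_equation L a b c \<and> e \<in> {1, -1}}" for L :: "'a pt set"
  have fin: "finite (C L)" for L
  proof (cases "\<exists>a b c. has_equation L a b c")
    case True
    then obtain a b c where L: "has_equation L a b c" by blast
    have "H \<in> {{(x, y). a * x + b * y - c \<ge> 0}, {(x, y). a * x + b * y - c \<le> 0}}"
      if "H \<in> C L" for H
    proof -
      from that obtain e a' b' c' where H: "H = {(x, y). e * (a' * x + b' * y - c') \<ge> 0}"
        and L': "has_equation L a' b' c'" and e: "e \<in> {1, -1}"
        unfolding C_def by blast
      obtain s where s: "s \<noteq> 0" "a' = s * a" "b' = s * b" "c' = s * c"
        using has_equation_proportional[OF L L'] .
      have "e * (a' * x + b' * y - c') = (e * s) * (a * x + b * y - c)" for x y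
        by (simp add: s algebra_simps)
      then have H2: "H = {(x, y). (e * s) * (a * x + b * y - c) \<ge> 0}"
        using H by presburger
      have "e * s > 0 \<or> e * s < 0"
        using s(1) e by auto
      then show ?thesis
      proof
        assume "e * s > 0"
        then have "(e * s) * u \<ge> 0 \<longleftrightarrow> u \<ge> 0" for u
          by (meson zero_le_mult_iff less_le_not_le order_less_imp_le)
        then show ?thesis unfolding H2 by simp
      next
        assume "e * s < 0"
        then have "(e * s) * u \<ge> 0 \<longleftrightarrow> u \<le> 0" for u
          by (meson zero_le_mult_iff less_le_not_le order_less_imp_le)
        then show ?thesis unfolding H2 by simp
      qed
    qed
    then have "C L \<subseteq> {{(x, y). a * x + b * y - c \<ge> 0}, {(x, y). a * x + b * y - c \<le> 0}}"
      by blast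
    then show ?thesis
      by (rule finite_subset) simp
  next
    case False
    then have "C L = {}" by (auto simp: C_def)
    then show ?thesis by simp
  qed
  have "{R. is_region A R} \<subseteq> Inter ` Pow (\<Union>L\<in>A. C L)"
  proof
    fix R assume "R \<in> {R. is_region A R}"
    then obtain a b c e where
      eqs: "\<forall>L\<in>A. has_equation L (a L) (b L) (c L) \<and> e L \<in> {1, -1}"
      and R: "R = {(x, y). \<forall>L\<in>A. e L * (a L * x + b L * y - c L) \<ge> 0}"
      unfolding is_region_def mem_Collect_eq by blast
    let ?H = "\<lambda>L. {(x, y). e L * (a L * x + b L * y - c L) \<ge> 0}"
    have "?H L \<in> C L" if "L \<in> A" for L
      unfolding C_def using eqs that by blast
    then have "?H ` A \<in> Pow (\<Union>L\<in>A. C L)"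
      by blast
    moreover have "R = \<Inter> (?H ` A)"
      unfolding R by auto
    ultimately show "R \<in> Inter ` Pow (\<Union>L\<in>A. C L)"
      by blast
  qed
  moreover have "finite (Inter ` Pow (\<Union>L\<in>A. C L))"
    using assms fin by simp
  ultimately show ?thesis
    by (rule finite_subset)
qed

end

(* Orient the equations so that P = {l_i >= 0 for all i}, and let A_i be the coefficient vector of
   l_i in F^3. Then det(A_i, A_j, A_k) > 0 for i < j < k, so four of the vectors satisfy a linear
   relation with alternating signs. Hence the sign vector of a region, or of a direction, has at most
   two cyclic sign changes: up to a global sign its negative entries form an interval {i, ..., j-1}
   with 1 <= i < j <= n, or none. This gives (n choose 2) + 1 classes of opposite sign vectors. At
   the intersection point of L_x and L_y the signs are those of det(A_x, A_y, A_q), up to one global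
   sign; so each class contains a region, and the lines that meet a bounded region of the class are
   L_(i-1), L_i, L_(j-1), L_j. Three of them are distinct if the interval or its complement is a
   single index, and four otherwise. A class contains no bounded region iff it is the sign vector of a
   direction; rotating a direction by a half turn changes one sign at a time, so there are exactly n
   such classes. The class with single index i is bounded iff i is separating. *)

theory Submission
  imports Defs
begin

text \<open>The polygon fixes the signs of all determinants \<open>D\<close>, but not the signs of
  the cross products \<open>d\<close> of non-consecutive lines; it is there that arrangements with
  the same n can differ. Since \<open>d x y * lf q p = D x y q\<close> at the vertex p of lines x
  and y, the forms at p are known up to the sign of \<open>d x y\<close>. This is why opposite sign
  vectors are counted together: the classes and the lines meeting their bounded regions are
  independent of the arrangement, while the choice of region in a class and its boundedness are
  governed by \<open>d\<close>.

  An arbitrary ordered field offers no compactness and no limits. Boundedness therefore becomes the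
  absence of a direction with the signs of the region, and every passage from a boundary point to an
  interior point is an explicit small step.

  For n = 3 and n = 4 a second triangle or quadrilateral would be a second n-gon; it is excluded
  because k is then 0 or 2, respectively.\<close>

section \<open>Explicit perturbation bounds and two finite counts\<close>

lemma finite_small_perturbation:
  fixes g h :: "'b \<Rightarrow> 'a::linordered_field"
  assumes "finite K" "\<And>k. k \<in> K \<Longrightarrow> g k > 0"
  shows "\<exists>e>0. \<forall>t. 0 < t \<and> t \<le> e \<longrightarrow> (\<forall>k\<in>K. g k + t * h k > 0)"
  using assms
proof (induction K)
  case empty
  show ?case by (rule exI[of _ 1]) simp
next
  case (insert x K)
  then obtain e where e: "e > 0" "\<And>t k. 0 < t \<Longrightarrow> t \<le> e \<Longrightarrow> k \<in> K \<Longrightarrow> g k + t * h k > 0"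
    by auto
  \<comment> \<open>With this bound, a step t costs at most \<open>g x - t\<close>; the summand 1
    provides this margin and covers \<open>h x = 0\<close>.\<close>
  define e' where "e' = g x / (1 + \<bar>h x\<bar>)"
  have gx: "g x > 0" using insert by simp
  have e': "e' > 0" using gx by (simp add: e'_def add_pos_nonneg)
  have "g x + t * h x > 0" if t: "0 < t" "t \<le> e'" for t
  proof -
    have "t * (1 + \<bar>h x\<bar>) \<le> g x"
      using t by (simp add: e'_def pos_le_divide_eq add_pos_nonneg)
    moreover have "- (t * h x) \<le> t * \<bar>h x\<bar>"
      using t(1) by (metis abs_ge_minus_self minus_mult_right mult_left_mono less_imp_le)
    ultimately show ?thesis using t(1) by (simp add: algebra_simps)
  qed
  then show ?case
    using e e' by (intro exI[of _ "min e e'"]) auto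
qed

text \<open>A new maximum b adds one cut, the whole set, and loses none, because an old cut can be
  made with a threshold below b.\<close>

lemma card_cuts:
  fixes S :: "'a::{dense_linorder,no_top,no_bot} set"
  assumes "finite S"
  shows "card {{x \<in> S. x < r} |r. r \<notin> S} = card S + 1"
  using assms
proof (induction S rule: finite_linorder_max_induct)
  case empty
  then show ?case by simp
next
  case (insert b S)
  have less_b: "\<And>x. x \<in> S \<Longrightarrow> x < b" and "finite S" using insert by auto
  then have b: "b \<notin> S" by blast
  let ?C = "\<lambda>S. {{x \<in> S. x < r} |r. r \<notin> S}"
  have step: "card C' = Suc (card C)" if "C' = insert X C" "X \<notin> C" "finite C"
    for C' C :: "'a set set" and X
    using that by simp
  have step2: "u = v + 1" if "u = Suc u'" "v = Suc v'" "u' = v' + 1" for u v u' v' :: nat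
    using that by simp
  \<comment> \<open>A threshold at or above b cuts off all of S; by density it can be replaced by
    one between S and b, or by any one below b if S is empty.\<close>
  have below: "\<exists>r'. r' \<notin> insert b S \<and> {x \<in> S. x < r} = {x \<in> insert b S. x < r'}" if "r \<notin> S" for r
  proof (cases "r < b")
    case True
    with that show ?thesis by (intro exI[of _ r]) auto
  next
    case False
    obtain r' where r': "r' < b" "\<forall>x\<in>S. x < r'"
    proof (cases "S = {}")
      case True
      then show ?thesis using lt_ex[of b] that by auto
    next
      case False
      then obtain r' where "Max S < r'" "r' < b"
        using less_b \<open>finite S\<close> dense[of "Max S" b] by auto
      then show ?thesis using that \<open>finite S\<close> False by (metis Max_less_iff)
    qed
    have "{x \<in> S. x < r} = {x \<in> insert b S. x < r'}"
    proof -
      have "x < r" if "x \<in> S" for x using less_b[OF that] False by simp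
      then show ?thesis using r' by auto
    qed
    then show ?thesis using r' by (intro exI[of _ r']) auto
  qed
  have "?C (insert b S) = insert (insert b S) (?C S)"
  proof (intro subset_antisym subsetI)
    fix X assume "X \<in> ?C (insert b S)"
    then obtain r where r: "r \<notin> insert b S" "X = {x \<in> insert b S. x < r}" by blast
    show "X \<in> insert (insert b S) (?C S)"
    proof (cases "r < b")
      case True
      then have "X = {x \<in> S. x < r}" using r by auto
      then show ?thesis using r(1) by blast
    next
      case False
      then have "b < r" using r(1) by (metis insertI1 neqE)
      then have "X = insert b S" using r(2) less_b less_trans by blast
      then show ?thesis by blast
    qed
  next
    fix X assume "X \<in> insert (insert b S) (?C S)"
    then consider "X = insert b S" | r where "r \<notin> S" "X = {x \<in> S. x < r}" by blast
    then show "X \<in> ?C (insert b S)"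
    proof cases
      case 1
      obtain r where r: "b < r" using gt_ex by blast
      have "r \<notin> insert b S" "insert b S = {x \<in> insert b S. x < r}"
        using r less_b less_trans by blast+
      then show ?thesis using 1 by blast
    next
      case 2
      then show ?thesis using below[of r] by blast
    qed
  qed
  moreover have "insert b S \<notin> ?C S" using b by auto
  moreover have "finite (?C S)"
    by (rule finite_subset[of _ "Pow S"]) (use \<open>finite S\<close> in auto)
  ultimately have "card (?C (insert b S)) = Suc (card (?C S))"
    by (rule step)
  moreover have "card (insert b S) = Suc (card S)"
    using \<open>finite S\<close> b by (rule card_insert_disjoint)
  ultimately show ?case
    using insert.IH by (rule step2)
qed

lemma card_pairs: "card {(i, j). 1 \<le> i \<and> i < j \<and> j \<le> (m::nat)} = m choose 2"
proof (induction m)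
  case 0
  have e: "{(i, j). 1 \<le> i \<and> i < j \<and> j \<le> (0::nat)} = {}" by auto
  show ?case unfolding e by simp
next
  case (Suc m)
  have fin: "finite {(i, j). 1 \<le> i \<and> i < j \<and> j \<le> m}"
    by (rule finite_subset[of _ "{..m} \<times> {..m}"]) auto
  have "{(i, j). 1 \<le> i \<and> i < j \<and> j \<le> Suc m}
    = {(i, j). 1 \<le> i \<and> i < j \<and> j \<le> m} \<union> (\<lambda>i. (i, Suc m)) ` {1..m}"
    by auto
  then have "card {(i, j). 1 \<le> i \<and> i < j \<and> j \<le> Suc m}
    = card {(i, j). 1 \<le> i \<and> i < j \<and> j \<le> m} + card ((\<lambda>i. (i, Suc m)) ` {1..m})"
    using fin by (simp only:) (rule card_Un_disjoint, auto)
  also have "card ((\<lambda>i. (i, Suc m)) ` {1..m}) = m"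
    by (subst card_image) (auto simp: inj_on_def)
  finally show ?case using Suc by (simp add: numeral_2_eq_2)
qed

lemma segment_iff: "r \<in> segment p q \<longleftrightarrow>
  (\<exists>t. 0 \<le> t \<and> t \<le> 1 \<and> r = ((1 - t) * fst p + t * fst q, (1 - t) * snd p + t * snd q))"
  by (auto simp: segment_def)

section \<open>Linear forms, cross products and determinants\<close>

locale oriented_lines =
  fixes n :: nat and a b c :: "nat \<Rightarrow> 'a::linordered_field" and L :: "nat \<Rightarrow> 'a pt set"
  assumes n3: "3 \<le> n"
    and eqn: "\<And>i. i < n \<Longrightarrow> has_equation (L i) (a i) (b i) (c i)"
begin

definition lf :: "nat \<Rightarrow> 'a pt \<Rightarrow> 'a" where
  "lf i p = a i * fst p + b i * snd p - c i"

definition lin :: "nat \<Rightarrow> 'a pt \<Rightarrow> 'a" where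
  "lin i w = a i * fst w + b i * snd w"

definition d :: "nat \<Rightarrow> nat \<Rightarrow> 'a" where
  "d i j = a i * b j - a j * b i"

text \<open>The determinant of the rows \<open>(a, b, - c)\<close> with indices \<open>i\<close>, \<open>j\<close>, \<open>k\<close>.\<close>

definition D :: "nat \<Rightarrow> nat \<Rightarrow> nat \<Rightarrow> 'a" where
  "D i j k = c j * d i k - c i * d j k - c k * d i j"

lemma mem_L: "i < n \<Longrightarrow> p \<in> L i \<longleftrightarrow> lf i p = 0"
  using eqn[of i] by (auto simp: has_equation_def lf_def split: prod.splits)

lemma lf_add: "lf i (fst p + t * fst w, snd p + t * snd w) = lf i p + t * lin i w"
  by (simp add: lf_def lin_def algebra_simps)

lemma lin_add: "lin i (fst p + t * fst w, snd p + t * snd w) = lin i p + t * lin i w"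
  by (simp add: lin_def algebra_simps)

lemma lin_diff: "lin i (fst p - fst q, snd p - snd q) = lf i p - lf i q"
  by (simp add: lf_def lin_def algebra_simps)

lemma lf_segment: "lf i ((1 - t) * fst p + t * fst q, (1 - t) * snd p + t * snd q)
    = (1 - t) * lf i p + t * lf i q"
  by (simp add: lf_def algebra_simps)

lemma d_commute: "d j i = - d i j"
  by (simp add: d_def)

lemma D_permute:
  "D j k i = D i j k" "D k i j = D i j k" "D j i k = - D i j k" "D i k j = - D i j k" "D k j i = - D i j k"
  unfolding D_def d_def by algebra+

text \<open>Adding the multiples \<open>fst p\<close> and \<open>snd p\<close> of the first two
  columns to the third turns it into the values of the forms at p, of which only the one in row q
  can be nonzero.\<close>

lemma d_times_lf: "lf x p = 0 \<Longrightarrow> lf y p = 0 \<Longrightarrow> d x y * lf q p = D x y q"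
proof -
  assume "lf x p = 0" "lf y p = 0"
  then have "c x = a x * fst p + b x * snd p" "c y = a y * fst p + b y * snd p"
    by (simp_all add: lf_def)
  then show ?thesis unfolding lf_def D_def d_def by algebra
qed

text \<open>Cramer's relation between four rows in dimension three, paired with the vector (p, 1);
  pairing with (w, 0) gives the version for directions.\<close>

lemma four_term_lf: "D j k l * lf i p + D i j l * lf k p = D i k l * lf j p + D i j k * lf l p"
  unfolding lf_def D_def d_def by algebra

lemma four_term_lin: "D j k l * lin i w + D i j l * lin k w = D i k l * lin j w + D i j k * lin l w"
  unfolding lin_def D_def d_def by algebra

lemma three_term_lin: "d j k * lin i w + d i j * lin k w = d i k * lin j w"
  unfolding lin_def d_def by algebra

text \<open>The three-term Grassmann-Pluecker relation, with i in all six determinants.\<close>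

lemma pluecker: "D i g k * D i j l = D i g j * D i k l + D i g l * D i j k"
  unfolding D_def d_def by algebra

text \<open>Triples with two consecutive indices generate the rest: the Pluecker relation with
  \<open>g = i + 1\<close> expresses \<open>D i j (m + 1)\<close>, up to a positive factor, as a sum
  of products of determinants already known to be positive.\<close>

lemma D_pos_of_consecutive:
  assumes "\<And>i k. i + 1 < n \<Longrightarrow> k < n \<Longrightarrow> k \<noteq> i \<Longrightarrow> k \<noteq> i + 1 \<Longrightarrow> D i (i + 1) k > 0"
  assumes "i < j" "j < k" "k < n"
  shows "D i j k > 0"
proof -
  have base: "D i (i + 1) m > 0" if "i + 1 < m" "m < n" for m
    using assms(1)[of i m] that by auto
  have step: "D i m (m + 1) > 0" if "i < m" "m + 1 < n" for m
    using assms(1)[of m i] that D_permute(1)[where i = i and j = m and k = "m + 1"] by simp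
  have "Suc j \<le> k" using assms by simp
  then show ?thesis
    using \<open>k < n\<close>
  proof (induction k rule: dec_induct)
    case base
    then show ?case using step[of j] assms by simp
  next
    case (step m)
    then have IH: "D i j m > 0" by simp
    show ?case
    proof (cases "j = i + 1")
      case True
      then show ?thesis using base[of "Suc m"] step by simp
    next
      case False
      have "D i (i + 1) m * D i j (Suc m)
          = D i (i + 1) j * D i m (m + 1) + D i (i + 1) (m + 1) * D i j m"
        using pluecker[of i "i + 1" m j "m + 1"] by simp
      moreover have "D i (i + 1) j * D i m (m + 1) > 0"
        using False assms step base[of j] \<open>\<And>m. i < m \<Longrightarrow> m + 1 < n \<Longrightarrow> D i m (m + 1) > 0\<close>[of m] by simp
      moreover have "D i (i + 1) (m + 1) * D i j m > 0"
        using assms step base[of "m + 1"] IH by simp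
      ultimately have "D i (i + 1) m * D i j (Suc m) > 0" by simp
      moreover have "D i (i + 1) m > 0" using base[of m] assms step by simp
      ultimately show ?thesis by (simp add: zero_less_mult_iff)
    qed
  qed
qed

lemma meet_in:
  assumes "x < n" "y < n" "d x y \<noteq> 0"
  shows "lf x (meet (L x) (L y)) = 0" "lf y (meet (L x) (L y)) = 0"
proof -
  define p where "p = ((c x * b y - c y * b x) / d x y, (a x * c y - a y * c x) / d x y)"
  have *: "p' = p \<longleftrightarrow> lf x p' = 0 \<and> lf y p' = 0" for p'
  proof
    have "a x * (c x * b y - c y * b x) + b x * (a x * c y - a y * c x) = c x * d x y"
      "a y * (c x * b y - c y * b x) + b y * (a x * c y - a y * c x) = c y * d x y"
      by (simp_all add: d_def algebra_simps)
    then have "lf x p = 0" "lf y p = 0"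
      using assms(3) by (simp_all add: p_def lf_def add_divide_distrib[symmetric])
    then show "p' = p \<Longrightarrow> lf x p' = 0 \<and> lf y p' = 0" by simp
  next
    assume "lf x p' = 0 \<and> lf y p' = 0"
    then have "c x = a x * fst p' + b x * snd p'" "c y = a y * fst p' + b y * snd p'"
      by (simp_all add: lf_def)
    then have "d x y * fst p' = c x * b y - c y * b x" "d x y * snd p' = a x * c y - a y * c x"
      by (simp_all add: d_def algebra_simps)
    then show "p' = p"
      using assms(3) by (simp add: p_def prod_eq_iff eq_divide_eq mult.commute)
  qed
  have "meet (L x) (L y) = p"
    unfolding meet_def using assms by (intro the_equality) (auto simp: mem_L *[symmetric])
  then show "lf x (meet (L x) (L y)) = 0" "lf y (meet (L x) (L y)) = 0"
    using * by auto
qed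

lemma direction_exists:
  assumes "d x y \<noteq> 0"
  obtains w where "lin x w = s" "lin y w = t"
proof
  let ?w = "((s * b y - t * b x) / d x y, (a x * t - a y * s) / d x y)"
  have "a x * (s * b y - t * b x) + b x * (a x * t - a y * s) = s * d x y"
    "a y * (s * b y - t * b x) + b y * (a x * t - a y * s) = t * d x y"
    by (simp_all add: d_def algebra_simps)
  then show "lin x ?w = s" "lin y ?w = t"
    using assms by (simp_all add: lin_def add_divide_distrib[symmetric])
qed

lemma open_half_planes_L:
  assumes "i < n"
  shows "open_half_planes (L i) = {{p. lf i p > 0}, {p. lf i p < 0}}"
proof (intro subset_antisym subsetI)
  fix H assume "H \<in> open_half_planes (L i)"
  then obtain a' b' c' where H: "H = {(x, y). a' * x + b' * y > c'}" and e: "has_equation (L i) a' b' c'"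
    by (auto simp: open_half_planes_def)
  obtain s where s: "s \<noteq> 0" "a' = s * a i" "b' = s * b i" "c' = s * c i"
    using has_equation_proportional[OF eqn[OF assms] e] .
  have "a' * fst p + b' * snd p > c' \<longleftrightarrow> s * lf i p > 0" for p
    by (simp add: s lf_def algebra_simps)
  then have "H = {p. s * lf i p > 0}" unfolding H by auto
  moreover have "s > 0 \<or> s < 0" using s(1) by auto
  ultimately show "H \<in> {{p. lf i p > 0}, {p. lf i p < 0}}"
    by (auto simp: zero_less_mult_iff)
next
  fix H assume "H \<in> {{p. lf i p > 0}, {p. lf i p < 0}}"
  moreover have "{p. lf i p > 0} = {(x, y). a i * x + b i * y > c i}"
    "{p. lf i p < 0} = {(x, y). - a i * x + - b i * y > - c i}"
    by (auto simp: lf_def)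
  ultimately consider "H = {(x, y). a i * x + b i * y > c i}"
    | "H = {(x, y). - a i * x + - b i * y > - c i}"
    by auto
  then show "H \<in> open_half_planes (L i)"
  proof cases
    case 1
    then show ?thesis using eqn[OF assms] by (auto simp: open_half_planes_def)
  next
    case 2
    have "has_equation (L i) (- a i) (- b i) (- c i)"
      using eqn[OF assms] by (auto simp: has_equation_def)
    then show ?thesis unfolding 2 open_half_planes_def by blast
  qed
qed

end

text \<open>A sign vector is encoded by the set of the indices of its negative entries.\<close>

definition sg :: "nat set \<Rightarrow> nat \<Rightarrow> 'a::linordered_field" where
  "sg N k = (if k \<in> N then - 1 else 1)"

lemma sg_mult_pos: "sg N k * x > 0 \<longleftrightarrow> (if k \<in> N then x < 0 else x > 0)"
  by (simp add: sg_def)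

lemma sg_mult_nonneg: "sg N k * x \<ge> 0 \<longleftrightarrow> (if k \<in> N then x \<le> 0 else x \<ge> 0)"
  by (simp add: sg_def)

lemma sg_compl: "k < n \<Longrightarrow> sg ({..<n} - N) k = - sg N k"
  by (simp add: sg_def)

section \<open>Regions as sign vectors\<close>

context oriented_lines
begin

definition realised :: "nat set \<Rightarrow> bool" where
  "realised N \<longleftrightarrow> (\<exists>p. \<forall>k<n. sg N k * lf k p > 0)"

definition reg :: "nat set \<Rightarrow> 'a pt set" where
  "reg N = {p. \<forall>k<n. sg N k * lf k p \<ge> 0}"

text \<open>For a realised sign vector this means that its region is unbounded (\<open>bounded_reg\<close>); it does
  not change when all signs are flipped.\<close>

definition recedes :: "nat set \<Rightarrow> bool" where
  "recedes N \<longleftrightarrow> (\<exists>w. \<forall>k<n. sg N k * lin k w > 0)"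

lemma is_region_reg:
  assumes "inj_on L {..<n}"
  shows "is_region (L ` {..<n}) R \<longleftrightarrow> (\<exists>N\<subseteq>{..<n}. realised N \<and> R = reg N)"
proof
  assume "is_region (L ` {..<n}) R"
  then obtain a' b' c' e x y where
    eqs: "\<forall>l\<in>L ` {..<n}. has_equation l (a' l) (b' l) (c' l) \<and> e l \<in> {1, -1}"
    and R: "R = {(x, y). \<forall>l\<in>L ` {..<n}. e l * (a' l * x + b' l * y - c' l) \<ge> 0}"
    and xy: "\<forall>l\<in>L ` {..<n}. e l * (a' l * x + b' l * y - c' l) > 0"
    unfolding is_region_def by (elim exE conjE) (rule that)
  \<comment> \<open>Equations of a line agree up to a factor, so each signed form is a nonzero
    multiple of \<open>lf k\<close>; the sign of the factor decides membership in N.\<close>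
  have "\<exists>s. s \<noteq> 0 \<and> (\<forall>p. e (L k) * (a' (L k) * fst p + b' (L k) * snd p - c' (L k)) = s * lf k p)"
    if kn: "k < n" for k
  proof -
    have ek: "has_equation (L k) (a' (L k)) (b' (L k)) (c' (L k))"
      using eqs that by blast
    obtain s where s: "s \<noteq> 0" "a' (L k) = s * a k" "b' (L k) = s * b k" "c' (L k) = s * c k"
      using has_equation_proportional[OF eqn[OF kn] ek] .
    have "e (L k) * s \<noteq> 0" using eqs that s(1) by force
    moreover have "e (L k) * (a' (L k) * fst p + b' (L k) * snd p - c' (L k)) = (e (L k) * s) * lf k p" for p
      by (simp add: s lf_def algebra_simps)
    ultimately show ?thesis by blast
  qed
  then obtain s where s: "\<And>k. k < n \<Longrightarrow> s k \<noteq> 0"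
    "\<And>k p. k < n \<Longrightarrow> e (L k) * (a' (L k) * fst p + b' (L k) * snd p - c' (L k)) = s k * lf k p"
    by metis
  define N where "N = {k. k < n \<and> s k < 0}"
  have pos: "s k * x > 0 \<longleftrightarrow> sg N k * x > 0" if "k < n" for k and x :: 'a
    using s(1)[OF that] that by (auto simp: N_def sg_def zero_less_mult_iff)
  have nonneg: "s k * x \<ge> 0 \<longleftrightarrow> sg N k * x \<ge> 0" if "k < n" for k and x :: 'a
    using s(1)[OF that] that by (auto simp: N_def sg_def zero_le_mult_iff)
  have "N \<subseteq> {..<n}" by (auto simp: N_def)
  moreover have "realised N"
  proof -
    have "sg N k * lf k (x, y) > 0" if "k < n" for k
    proof -
      have "e (L k) * (a' (L k) * x + b' (L k) * y - c' (L k)) > 0"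
        using xy that by blast
      then have "s k * lf k (x, y) > 0" using s(2)[OF that, of "(x, y)"] by simp
      then show ?thesis using pos[OF that] by blast
    qed
    then show ?thesis unfolding realised_def by blast
  qed
  moreover have "R = reg N"
    unfolding R reg_def using s(2) nonneg by (auto simp: lessThan_iff)
  ultimately show "\<exists>N\<subseteq>{..<n}. realised N \<and> R = reg N" by blast
next
  assume "\<exists>N\<subseteq>{..<n}. realised N \<and> R = reg N"
  then obtain N where N: "realised N" "R = reg N" by blast
  \<comment> \<open>\<open>is_region\<close> attaches coefficients to lines, not to indices;
    injectivity of \<open>L\<close> recovers the index.\<close>
  define idx where "idx = the_inv_into {..<n} L"
  have idx: "idx (L k) = k" if "k < n" for k
    unfolding idx_def using the_inv_into_f_f[OF assms] that by simp
  obtain p where p: "\<And>k. k < n \<Longrightarrow> sg N k * lf k p > 0"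
    using N unfolding realised_def by blast
  show "is_region (L ` {..<n}) R"
    unfolding is_region_def
  proof (rule exI[of _ "\<lambda>l. a (idx l)"], rule exI[of _ "\<lambda>l. b (idx l)"],
      rule exI[of _ "\<lambda>l. c (idx l)"], rule exI[of _ "\<lambda>l. sg N (idx l)"], intro conjI)
    show "\<forall>l\<in>L ` {..<n}. has_equation l (a (idx l)) (b (idx l)) (c (idx l)) \<and> sg N (idx l) \<in> {1, - 1}"
      using idx eqn by (auto simp: sg_def)
    show "R = {(x, y). \<forall>l\<in>L ` {..<n}. 0 \<le> sg N (idx l) * (a (idx l) * x + b (idx l) * y - c (idx l))}"
      unfolding N reg_def lf_def using idx by auto
    show "\<exists>x y. \<forall>l\<in>L ` {..<n}. 0 < sg N (idx l) * (a (idx l) * x + b (idx l) * y - c (idx l))"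
      using p idx by (rule_tac exI[of _ "fst p"], rule_tac exI[of _ "snd p"]) (auto simp: lf_def)
  qed
qed

lemma reg_inject:
  assumes "realised N" "N \<subseteq> {..<n}" "N' \<subseteq> {..<n}" "reg N = reg N'"
  shows "N = N'"
proof -
  obtain p where p: "\<And>k. k < n \<Longrightarrow> sg N k * lf k p > 0"
    using assms unfolding realised_def by blast
  have "p \<in> reg N" unfolding reg_def using p by (simp add: less_imp_le)
  then have "p \<in> reg N'" using assms(4) by simp
  then have "\<And>k. k < n \<Longrightarrow> sg N' k * lf k p \<ge> 0" by (simp add: reg_def)
  then have "k \<in> N \<longleftrightarrow> k \<in> N'" if "k < n" for k
    using p[OF that] that by (force simp: sg_mult_pos sg_mult_nonneg split: if_splits)
  then show ?thesis using assms(2,3) by blast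
qed

lemma recedes_compl: "recedes ({..<n} - N) \<longleftrightarrow> recedes N"
proof -
  have *: "lin k (- fst w, - snd w) = - lin k w" for k w
    by (simp add: lin_def)
  show ?thesis
    unfolding recedes_def
    by (intro iffI; elim exE; rename_tac w; rule_tac x = "(- fst w, - snd w)" in exI)
      (auto simp: sg_compl *)
qed

text \<open>Along the difference of interior points of two opposite regions every form moves to its
  prescribed side.\<close>

lemma recedes_if_both_realised:
  assumes "realised N" "realised ({..<n} - N)"
  shows "recedes N"
proof -
  obtain p q where p: "\<And>k. k < n \<Longrightarrow> sg N k * lf k p > 0"
    and q: "\<And>k. k < n \<Longrightarrow> sg ({..<n} - N) k * lf k q > 0"
    using assms unfolding realised_def by blast
  have "sg N k * lin k (fst p - fst q, snd p - snd q) > 0" if "k < n" for k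
    using p[OF that] q[OF that] that by (simp add: lin_diff sg_compl right_diff_distrib)
  then show ?thesis unfolding recedes_def by blast
qed

end

section \<open>Unbounded regions and directions\<close>

locale simple_oriented_lines = oriented_lines +
  assumes d_ne: "\<And>i j. i < n \<Longrightarrow> j < n \<Longrightarrow> i \<noteq> j \<Longrightarrow> d i j \<noteq> 0"
begin

text \<open>A ray in a region may be parallel to a line, whereas \<open>recedes\<close> asks for
  strict signs. A nonzero direction is parallel to at most one line m; turning it slightly to the
  prescribed side of m keeps the other signs.\<close>

lemma recedes_if_weakly:
  assumes "\<And>k. k < n \<Longrightarrow> sg N k * lin k w \<ge> 0" "w \<noteq> (0, 0)"
  shows "recedes N"
proof -
  obtain m where m: "m < n" "\<And>k. k < n \<Longrightarrow> k \<noteq> m \<Longrightarrow> lin k w \<noteq> 0"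
  proof (cases "\<exists>m<n. lin m w = 0")
    case True
    then obtain m where m: "m < n" "lin m w = 0" by blast
    have "lin k w \<noteq> 0" if "k < n" "k \<noteq> m" for k
    proof
      assume "lin k w = 0"
      with m(2) have "d m k * fst w = 0" "d m k * snd w = 0"
        unfolding d_def lin_def by algebra+
      then show False using d_ne[OF m(1) that(1)] that(2) assms(2) by (auto simp: prod_eq_iff)
    qed
    then show ?thesis using that m by blast
  next
    case False
    then show ?thesis using that[of 0] n3 by auto
  qed
  have "(if m = 0 then 1 else 0) < n" "(if m = 0 then 1 else 0) \<noteq> m" using n3 by auto
  then obtain k where k: "k < n" "k \<noteq> m" by blast
  obtain z where z: "lin m z = sg N m" "lin k z = sg N k"
    using direction_exists d_ne m(1) k by metis
  have "\<exists>e>0. \<forall>t. 0 < t \<and> t \<le> e \<longrightarrow> (\<forall>k\<in>{..<n} - {m}. sg N k * lin k w + t * (sg N k * lin k z) > 0)"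
  proof (rule finite_small_perturbation)
    fix k assume "k \<in> {..<n} - {m}"
    then have "sg N k * lin k w \<ge> 0" "sg N k * lin k w \<noteq> 0"
      using assms(1)[of k] m(2)[of k] by (auto simp: sg_def)
    then show "sg N k * lin k w > 0" by linarith
  qed simp
  then obtain e where e: "e > 0" "\<And>k. k < n \<Longrightarrow> k \<noteq> m \<Longrightarrow> sg N k * lin k w + e * (sg N k * lin k z) > 0"
    by auto
  have "sg N k * lin k (fst w + e * fst z, snd w + e * snd z) > 0" if "k < n" for k
  proof (cases "k = m")
    case True
    have "sg N m * lin m w \<ge> 0" using assms m by blast
    moreover have "sg N m * (sg N m :: 'a) = 1" by (simp add: sg_def)
    ultimately show ?thesis using True e(1) z(1)
      by (simp add: lin_add distrib_left mult.left_commute[of _ e] add_nonneg_pos)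
  next
    case False
    then show ?thesis using e(2)[OF that] by (simp add: lin_add distrib_left mult.left_commute)
  qed
  then show ?thesis unfolding recedes_def by blast
qed

lemma bounded_reg:
  assumes "realised N"
  shows "bounded_set (reg N) \<longleftrightarrow> \<not> recedes N"
proof
  assume bd: "bounded_set (reg N)"
  show "\<not> recedes N"
  proof
    assume "recedes N"
    then obtain w where w: "\<And>k. k < n \<Longrightarrow> sg N k * lin k w > 0" unfolding recedes_def by blast
    have "w \<noteq> (0, 0)" using w[of 0] n3 by (auto simp: lin_def)
    obtain v where v: "\<And>k. k < n \<Longrightarrow> sg N k * lf k v > 0"
      using assms unfolding realised_def by blast
    have "(fst v + t * fst w, snd v + t * snd w) \<in> reg N" if "t \<ge> 0" for t
      unfolding reg_def mem_Collect_eq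
    proof (intro allI impI)
      fix k assume "k < n"
      then have "sg N k * lf k v + t * (sg N k * lin k w) \<ge> 0"
        using v w that by (simp add: less_imp_le)
      then show "sg N k * lf k (fst v + t * fst w, snd v + t * snd w) \<ge> 0"
        by (simp add: lf_add algebra_simps)
    qed
    then show False using bd \<open>w \<noteq> (0, 0)\<close> unfolding bounded_set_def by blast
  qed
next
  assume na: "\<not> recedes N"
  show "bounded_set (reg N)"
    unfolding bounded_set_def
  proof
    assume "\<exists>v w. w \<noteq> (0, 0) \<and> {(fst v + t * fst w, snd v + t * snd w) |t. t \<ge> 0} \<subseteq> reg N"
    then obtain v w where w: "w \<noteq> (0, 0)"
      and sub: "{(fst v + t * fst w, snd v + t * snd w) |t. t \<ge> 0} \<subseteq> reg N" by blast
    have ray: "(fst v + t * fst w, snd v + t * snd w) \<in> reg N" if "t \<ge> 0" for t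
      using sub that by blast
    have "sg N k * lin k w \<ge> 0" if "k < n" for k
    proof (rule ccontr)
      assume neg: "\<not> sg N k * lin k w \<ge> 0"
      \<comment> \<open>At this parameter the decrease exceeds the absolute value at v by one, so
        the signed form is at most -1.\<close>
      define t where "t = (1 + \<bar>lf k v\<bar>) / - (sg N k * lin k w)"
      have "t \<ge> 0" unfolding t_def by (rule divide_nonneg_nonneg) (use neg in auto)
      have "sg N k * lf k v + t * (sg N k * lin k w) \<ge> 0"
        using ray[OF \<open>t \<ge> 0\<close>] that by (simp add: reg_def lf_add algebra_simps)
      moreover have "x / - y * y = - x" if "\<not> y \<ge> 0" for x y :: 'a
        using that by auto
      then have "t * (sg N k * lin k w) = - (1 + \<bar>lf k v\<bar>)"
        unfolding t_def using neg by blast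
      moreover have "sg N k * lf k v \<le> \<bar>lf k v\<bar>"
        using abs_ge_self[of "lf k v"] abs_ge_minus_self[of "lf k v"] by (simp add: sg_def)
      ultimately show False by simp
    qed
    then show False using recedes_if_weakly w na by blast
  qed
qed

text \<open>At most the lines x and y pass through p. They are not parallel, so some direction leads
  to the prescribed side of both, and a short step along it changes no other sign.\<close>

lemma realised_near:
  assumes "x < n" "y < n" "x \<noteq> y" "p \<in> reg N"
    "\<And>q. q < n \<Longrightarrow> q \<noteq> x \<Longrightarrow> q \<noteq> y \<Longrightarrow> lf q p \<noteq> 0"
  shows "realised N"
proof -
  have p: "sg N k * lf k p \<ge> 0" if "k < n" for k
    using assms(4) that by (simp add: reg_def)
  obtain z where z: "lin x z = sg N x" "lin y z = sg N y"
    using direction_exists d_ne assms(1-3) by metis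
  have "\<exists>e>0. \<forall>t. 0 < t \<and> t \<le> e \<longrightarrow> (\<forall>k\<in>{..<n} - {x, y}. sg N k * lf k p + t * (sg N k * lin k z) > 0)"
  proof (rule finite_small_perturbation)
    fix k assume "k \<in> {..<n} - {x, y}"
    then have "sg N k * lf k p \<ge> 0" "sg N k * lf k p \<noteq> 0"
      using p[of k] assms(5)[of k] by (auto simp: sg_def)
    then show "sg N k * lf k p > 0" by linarith
  qed simp
  then obtain e where e: "e > 0"
    "\<And>k. k < n \<Longrightarrow> k \<notin> {x, y} \<Longrightarrow> sg N k * lf k p + e * (sg N k * lin k z) > 0"
    by auto
  have "sg N k * lf k (fst p + e * fst z, snd p + e * snd z) > 0" if "k < n" for k
  proof (cases "k \<in> {x, y}")
    case True
    then have "lin k z = sg N k" using z by auto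
    moreover have "sg N k * (sg N k :: 'a) = 1" by (simp add: sg_def)
    ultimately show ?thesis using p[OF that] e(1)
      by (simp add: lf_add distrib_left mult.left_commute[of _ e] add_nonneg_pos)
  next
    case False
    then show ?thesis using e(2)[OF that] by (simp add: lf_add distrib_left mult.left_commute)
  qed
  then show ?thesis unfolding realised_def by blast
qed

end

subsection \<open>Signs at the intersection points\<close>

text \<open>What a gonality yields for the oriented equations: consecutive normals turn
  anticlockwise, also from the last line to the first. For other pairs the sign of \<open>d\<close>
  stays open.\<close>

locale polygon_lines = simple_oriented_lines +
  assumes D_pos: "\<And>i j k. i < j \<Longrightarrow> j < k \<Longrightarrow> k < n \<Longrightarrow> D i j k > 0"
    and d_next: "\<And>i. i + 1 < n \<Longrightarrow> d i (i + 1) > 0"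
    and d_last: "d (n - 1) 0 > 0"
    and inj: "inj_on L {..<n}"
    and not_recedes_empty: "\<not> recedes {}"
begin

lemma D_pos_right: "i < j \<Longrightarrow> j < q \<Longrightarrow> q < n \<Longrightarrow> D i j q > 0"
  and D_neg_between: "i < q \<Longrightarrow> q < j \<Longrightarrow> j < n \<Longrightarrow> D i j q < 0"
  and D_pos_left: "q < i \<Longrightarrow> i < j \<Longrightarrow> j < n \<Longrightarrow> D i j q > 0"
  using D_pos[of i j q] D_pos[of i q j] D_pos[of q i j] D_permute(4)[where i = i and j = q and k = j]
    D_permute(1)[where i = q and j = i and k = j] by simp_all

lemma D_ne_sorted: "i < j \<Longrightarrow> j < n \<Longrightarrow> q < n \<Longrightarrow> q \<noteq> i \<Longrightarrow> q \<noteq> j \<Longrightarrow> D i j q \<noteq> 0"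
  using D_pos_right[of i j q] D_neg_between[of i q j] D_pos_left[of q i j] by (metis less_irrefl linorder_neqE_nat)

lemma D_ne:
  assumes "i < n" "j < n" "k < n" "i \<noteq> j" "i \<noteq> k" "j \<noteq> k"
  shows "D i j k \<noteq> 0"
  using D_ne_sorted[of i j k] D_ne_sorted[of j i k] assms D_permute(3)[where i = i and j = j and k = k]
  by (cases i j rule: linorder_cases) simp_all

lemma lf_ne_at_vertex:
  assumes "x < n" "y < n" "q < n" "x \<noteq> y" "q \<noteq> x" "q \<noteq> y" "lf x p = 0" "lf y p = 0"
  shows "lf q p \<noteq> 0"
  using d_times_lf[OF assms(7,8), of q] D_ne[of x y q] assms by auto

text \<open>The coefficients of the linear relation between four of the forms alternate in sign.\<close>

lemma no_alternation:
  assumes "realised N \<or> recedes N" "i < j" "j < k" "k < l" "l < n"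
    "i \<in> N \<longleftrightarrow> k \<in> N" "j \<in> N \<longleftrightarrow> l \<in> N" "i \<in> N \<longleftrightarrow> j \<notin> N"
  shows False
proof -
  obtain g :: "nat \<Rightarrow> 'a" where g: "\<And>k. k < n \<Longrightarrow> sg N k * g k > 0"
    "D j k l * g i + D i j l * g k = D i k l * g j + D i j k * g l"
  proof -
    from assms(1) show thesis
    proof
      assume "realised N"
      then obtain p where "\<And>k. k < n \<Longrightarrow> sg N k * lf k p > 0" unfolding realised_def by blast
      then show thesis using that[of "\<lambda>k. lf k p"] four_term_lf by blast
    next
      assume "recedes N"
      then obtain w where "\<And>k. k < n \<Longrightarrow> sg N k * lin k w > 0" unfolding recedes_def by blast
      then show thesis using that[of "\<lambda>k. lin k w"] four_term_lin by blast
    qed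
  qed
  have D: "D j k l > 0" "D i j l > 0" "D i k l > 0" "D i j k > 0"
    using D_pos assms by auto
  show False
  proof (cases "i \<in> N")
    case True
    then have "g i < 0" "g k < 0" "g j > 0" "g l > 0"
      using g(1)[of i] g(1)[of j] g(1)[of k] g(1)[of l] assms by (auto simp: sg_mult_pos)
    then have "D j k l * g i < 0" "D i j l * g k < 0" "D i k l * g j > 0" "D i j k * g l > 0"
      using D by (auto simp: mult_pos_neg)
    then show False using g(2) by linarith
  next
    case False
    then have "g i > 0" "g k > 0" "g j < 0" "g l < 0"
      using g(1)[of i] g(1)[of j] g(1)[of k] g(1)[of l] assms by (auto simp: sg_mult_pos)
    then have "D j k l * g i > 0" "D i j l * g k > 0" "D i k l * g j < 0" "D i j k * g l < 0"
      using D by (auto simp: mult_pos_neg)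
    then show False using g(2) by linarith
  qed
qed

text \<open>The entry at 0 is positive. A gap x between the least and the greatest element of N
  would make the entries at 0, \<open>Min N\<close>, x, \<open>Max N\<close> alternate.\<close>

lemma interval_class:
  assumes "realised N \<or> realised ({..<n} - N) \<or> recedes N" "N \<subseteq> {..<n}" "0 \<notin> N" "N \<noteq> {}"
  obtains i j where "1 \<le> i" "i < j" "j \<le> n" "N = {i..<j}"
proof
  let ?i = "Min N" and ?j = "Suc (Max N)"
  have fin: "finite N" using assms(2) finite_subset by blast
  note mem = Min_in[OF fin assms(4)] Max_in[OF fin assms(4)]
  show "1 \<le> ?i" using mem assms(3) by (metis not_one_le_zero leI less_one)
  show "?i < ?j" using fin assms(4) mem by (simp add: less_Suc_eq_le)
  show "?j \<le> n" using mem assms(2) by auto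
  show "N = {?i..<?j}"
  proof (intro subset_antisym subsetI)
    fix x assume "x \<in> N"
    then show "x \<in> {?i..<?j}" using fin by (simp add: less_Suc_eq_le)
  next
    fix x assume x: "x \<in> {?i..<?j}"
    show "x \<in> N"
    proof (rule ccontr)
      assume "x \<notin> N"
      then have "?i < x" "x < Max N" using x mem by (auto simp: less_le less_Suc_eq_le)
      have "Max N < n" using mem(2) assms(2) by blast
      moreover note \<open>?i < x\<close> \<open>x < Max N\<close>
      moreover have "0 < ?i" using mem(1) assms(3) by (metis gr0I)
      moreover have "x < n" using \<open>x < Max N\<close> \<open>Max N < n\<close> by simp
      ultimately show False
        using no_alternation[of N 0 ?i x "Max N"] no_alternation[of "{..<n} - N" 0 ?i x "Max N"]
          assms(1,3) mem \<open>x \<notin> N\<close> by (metis (no_types, lifting) DiffE DiffI lessThan_iff less_trans)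
    qed
  qed
qed

text \<open>For \<open>x < y\<close> the determinant is negative exactly for q strictly between x
  and y. Both choices of x, and of y, give the same interval away from x and y themselves. If
  \<open>j = n\<close> and \<open>y = 0\<close>, swapping x and y makes it negative exactly beyond
  x.\<close>

lemma vertex_sign:
  assumes "1 \<le> i" "i < j" "j \<le> n" "x \<in> {i - 1, i}" "y \<in> {j - 1, j mod n}" "x \<noteq> y"
    "q < n" "q \<noteq> x" "q \<noteq> y"
  shows "sg {i..<j} q * D x y q > 0"
proof -
  show ?thesis
  proof (cases "j = n \<and> y = 0")
    case True
    moreover have "x < n" using assms(1-4) by auto
    ultimately have "x < q \<Longrightarrow> D x y q < 0" "q < x \<Longrightarrow> D x y q > 0"
      using D_pos_right[of 0 x q] D_neg_between[of 0 q x] D_permute(3)[where i = 0 and j = x and k = q] assms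
      by simp_all
    moreover have "q \<in> {i..<j} \<longleftrightarrow> x < q" using assms True by auto
    ultimately show ?thesis using assms(8) by (auto simp: sg_mult_pos)
  next
    case False
    then have y: "y \<in> {j - 1, j}" "y < n" using assms by (auto simp: mod_if split: if_splits)
    then have xy: "x < y" using assms(1-4,6) by auto
    have "q \<in> {i..<j} \<longleftrightarrow> x < q \<and> q < y"
      using assms y(1) xy by auto
    then show ?thesis
      using D_pos_right[of x y q] D_neg_between[of x q y] D_pos_left[of q x y] y(2) xy assms(7-9)
      by (auto simp: sg_mult_pos linorder_neq_iff)
  qed
qed

text \<open>The opposite sign vectors \<open>M\<close> and \<open>{..<n} - M\<close> form a class; at least one of them is realised,
  and not both if the class is bounded.\<close>

definition cls :: "nat set \<Rightarrow> nat set" where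
  "cls M = (if realised M then M else {..<n} - M)"

text \<open>The indices on both sides of the two sign changes; for \<open>j = n\<close> the second
  change is the one from the last index to 0.\<close>

definition ends :: "nat \<Rightarrow> nat \<Rightarrow> nat set" where
  "ends i j = {i - 1, i, j - 1, j mod n}"

text \<open>The determinants at this vertex carry the signs of the interval, so the sign of
  \<open>d x y\<close> alone decides which of the two opposite regions has it as a corner.\<close>

lemma vertex_reg:
  assumes "1 \<le> i" "i < j" "j \<le> n" "x \<in> {i - 1, i}" "y \<in> {j - 1, j mod n}" "x \<noteq> y"
    "lf x p = 0" "lf y p = 0"
  shows "if d x y > 0 then p \<in> reg {i..<j} \<and> realised {i..<j}
    else p \<in> reg ({..<n} - {i..<j}) \<and> realised ({..<n} - {i..<j})"
proof -
  have xy: "x < n" "y < n" using assms n3 by auto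
  have s: "sg {i..<j} q * (d x y * lf q p) > 0" if "q < n" "q \<noteq> x" "q \<noteq> y" for q
    unfolding d_times_lf[OF assms(7,8)] using vertex_sign assms(1-6) that by blast
  have ne: "lf q p \<noteq> 0" if "q < n" "q \<noteq> x" "q \<noteq> y" for q
    using s[OF that] by auto
  show ?thesis
  proof (cases "d x y > 0")
    case True
    have "sg {i..<j} q * lf q p \<ge> 0" if "q < n" for q
    proof (cases "q = x \<or> q = y")
      case True
      then show ?thesis using assms by auto
    next
      case False
      then show ?thesis using s[OF that] \<open>d x y > 0\<close>
        by (auto simp: sg_def zero_less_mult_iff mult_less_0_iff)
    qed
    then have "p \<in> reg {i..<j}" by (simp add: reg_def)
    then show ?thesis using True realised_near[OF xy assms(6) _ ne] by simp
  next
    case False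
    have "sg ({..<n} - {i..<j}) q * lf q p \<ge> 0" if "q < n" for q
    proof (cases "q = x \<or> q = y")
      case True
      then show ?thesis using assms by auto
    next
      case F: False
      then show ?thesis using s[OF that] \<open>\<not> d x y > 0\<close> that
        by (auto simp: sg_def zero_less_mult_iff mult_less_0_iff split: if_splits)
    qed
    then have "p \<in> reg ({..<n} - {i..<j})" by (simp add: reg_def)
    then show ?thesis using False realised_near[OF xy assms(6) _ ne] by simp
  qed
qed

lemma vertex_exists:
  assumes "x < n" "y < n" "x \<noteq> y"
  obtains p where "lf x p = 0" "lf y p = 0"
  using meet_in[of x y] d_ne assms by blast

lemma realised_cls:
  assumes "1 \<le> i" "i < j" "j \<le> n"
  shows "realised (cls {i..<j})"
proof -
  \<comment> \<open>The indices \<open>i - 1\<close> and \<open>j - 1\<close> differ for every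
    interval, even for one with a single element.\<close>
  obtain p where "lf (i - 1) p = 0" "lf (j - 1) p = 0"
    by (rule vertex_exists[of "i - 1" "j - 1"]) (use assms in auto)
  moreover have "i - 1 \<noteq> j - 1" using assms by auto
  ultimately show ?thesis
    using vertex_reg[of i j "i - 1" "j - 1" p] assms by (auto simp: cls_def split: if_splits)
qed

text \<open>All these vertices are corners of the same region: otherwise both opposite vectors would
  be realised and the class would recede.\<close>

lemma vertex_in_cls:
  assumes "1 \<le> i" "i < j" "j \<le> n" "x \<in> {i - 1, i}" "y \<in> {j - 1, j mod n}" "x \<noteq> y"
    "lf x p = 0" "lf y p = 0" "\<not> recedes {i..<j}"
  shows "p \<in> reg (cls {i..<j})"
  using vertex_reg[OF assms(1-8)] recedes_if_both_realised assms(9)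
  by (auto simp: cls_def split: if_splits)

lemma lf_unique:
  assumes "x < n" "y < n" "x \<noteq> y" "lf x p = lf x q" "lf y p = lf y q"
  shows "p = q"
proof -
  have "d x y * (fst p - fst q) = 0" "d x y * (snd p - snd q) = 0"
    using assms(4,5) unfolding lf_def d_def by algebra+
  then show ?thesis using d_ne[OF assms(1-3)] by (simp add: prod_eq_iff)
qed

subsection \<open>Sides of the bounded regions\<close>

text \<open>Along line m, form k vanishes at p and form l at q; their signs confine the region to
  the parameters from 0 to 1. Every other line is positive, up to its sign, at one end or both,
  hence cannot cut the segment in between.\<close>

lemma side_between_vertices:
  assumes "m < n" "k < n" "l < n" "m \<noteq> k" "m \<noteq> l" "k \<noteq> l"
    and p: "lf m p = 0" "lf k p = 0" and q: "lf m q = 0" "lf l q = 0"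
    and reg: "p \<in> reg N" "q \<in> reg N"
  shows "meets_in_side (L ` {..<n}) (L m) (reg N)"
proof -
  have sp: "sg N x * lf x p \<ge> 0" and sq: "sg N x * lf x q \<ge> 0" if "x < n" for x
    using reg that by (auto simp: reg_def)
  have sp': "sg N x * lf x p > 0" if "x < n" "x \<noteq> m" "x \<noteq> k" for x
    using sp[OF that(1)] lf_ne_at_vertex[OF assms(1,2) that(1) assms(4) that(2,3) p]
    by (auto simp: sg_def split: if_splits)
  have sq': "sg N x * lf x q > 0" if "x < n" "x \<noteq> m" "x \<noteq> l" for x
    using sq[OF that(1)] lf_ne_at_vertex[OF assms(1,3) that(1) assms(5) that(2,3) q]
    by (auto simp: sg_def split: if_splits)
  have nonneg: "x \<ge> 0" if "x * y \<ge> 0" "y > 0" for x y :: 'a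
    using that by (simp add: zero_le_mult_iff)
  have "p \<noteq> q" using sp'[of l] q(2) assms by auto
  have pq: "p \<in> segment p q" "q \<in> segment p q"
    unfolding segment_iff by (rule exI[of _ 0], simp) (rule exI[of _ 1], simp)
  have "L m \<inter> reg N = segment p q"
  proof (intro subset_antisym subsetI)
    fix r assume "r \<in> L m \<inter> reg N"
    then have r: "lf m r = 0" "\<And>x. x < n \<Longrightarrow> sg N x * lf x r \<ge> 0"
      using mem_L assms(1) by (auto simp: reg_def)
    \<comment> \<open>On line m, form k is proportional to the parameter, with value 0 at p and
      nonzero value at q.\<close>
    define t where "t = lf k r / lf k q"
    have kq: "sg N k * lf k q > 0" and lp: "sg N l * lf l p > 0"
      using sq'[of k] sp'[of l] assms by auto
    let ?r = "((1 - t) * fst p + t * fst q, (1 - t) * snd p + t * snd q)"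
    have "t * lf k q = lf k r" using kq by (auto simp: t_def)
    then have "lf m r = lf m ?r" "lf k r = lf k ?r"
      using r p q by (simp_all add: lf_segment)
    then have eq: "r = ?r" using lf_unique[of m k] assms by blast
    have "sg N k * lf k r = t * (sg N k * lf k q)"
      by (subst eq) (simp only: lf_segment p, simp add: algebra_simps)
    then have "t \<ge> 0" using r(2)[of k] kq assms(2) nonneg by metis
    have "sg N l * lf l r = (1 - t) * (sg N l * lf l p)"
      by (subst eq) (simp only: lf_segment q, simp add: algebra_simps)
    then have "1 - t \<ge> 0" using r(2)[of l] lp assms(3) nonneg by metis
    then show "r \<in> segment p q" unfolding segment_iff using eq \<open>t \<ge> 0\<close> by (intro exI[of _ t]) auto
  next
    fix r assume "r \<in> segment p q"
    then obtain t where t: "0 \<le> t" "t \<le> 1"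
      and r: "r = ((1 - t) * fst p + t * fst q, (1 - t) * snd p + t * snd q)"
      unfolding segment_iff by blast
    have "lf m r = 0" unfolding r lf_segment using p q by simp
    moreover have "sg N x * lf x r \<ge> 0" if "x < n" for x
    proof -
      have "(1 - t) * (sg N x * lf x p) + t * (sg N x * lf x q) \<ge> 0"
        using t sp[OF that] sq[OF that] by simp
      then show ?thesis unfolding r lf_segment by (simp add: algebra_simps)
    qed
    ultimately show "r \<in> L m \<inter> reg N" using mem_L assms(1) by (simp add: reg_def)
  qed
  moreover have "segment p q \<inter> intersection_points (L ` {..<n}) = {p, q}"
  proof (intro subset_antisym subsetI)
    fix r assume "r \<in> segment p q \<inter> intersection_points (L ` {..<n})"
    then have "r \<in> segment p q" "r \<in> intersection_points (L ` {..<n})" by blast+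
    then obtain t where t: "0 \<le> t" "t \<le> 1"
      and r: "r = ((1 - t) * fst p + t * fst q, (1 - t) * snd p + t * snd q)"
      unfolding segment_iff by blast
    obtain u v where uv: "u < n" "v < n" "L u \<noteq> L v" "r \<in> L u" "r \<in> L v"
      using \<open>r \<in> intersection_points (L ` {..<n})\<close> unfolding intersection_points_def by blast
    have "lf u r = 0" "lf v r = 0" "u \<noteq> v" using uv mem_L by auto
    then obtain x where x: "x < n" "x \<noteq> m" "lf x r = 0" using uv by metis
    have sum: "(1 - t) * (sg N x * lf x p) + t * (sg N x * lf x q) = 0"
      using x(3) unfolding r lf_segment by (simp add: sg_def)
    have "(1 - t) * (sg N x * lf x p) \<ge> 0" "t * (sg N x * lf x q) \<ge> 0"
      using t sp[OF x(1)] sq[OF x(1)] by simp_all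
    then have 0: "(1 - t) * (sg N x * lf x p) = 0" "t * (sg N x * lf x q) = 0"
      using sum by linarith+
    have "t = 0 \<or> t = 1"
    proof (cases "x = k")
      case True
      then show ?thesis using 0(2) sq'[of x] x assms by auto
    next
      case False
      then show ?thesis using 0(1) sp'[of x] x by auto
    qed
    then show "r \<in> {p, q}" using r by auto
  next
    fix r assume "r \<in> {p, q}"
    moreover have "L m \<noteq> L k" "L m \<noteq> L l" using inj assms by (auto simp: inj_on_def)
    moreover have "p \<in> L m" "p \<in> L k" "q \<in> L m" "q \<in> L l" using p q mem_L assms by auto
    ultimately have "r \<in> intersection_points (L ` {..<n})"
      unfolding intersection_points_def using assms(1-3) by blast
    then show "r \<in> segment p q \<inter> intersection_points (L ` {..<n})"
      using pq \<open>r \<in> {p, q}\<close> by blast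
  qed
  moreover have "p \<in> L m" "q \<in> L m" using p q mem_L assms by auto
  ultimately show ?thesis
    unfolding meets_in_side_def adjacent_def using \<open>p \<noteq> q\<close> by blast
qed

text \<open>A point of the region on line m also satisfies the weak inequalities across m, and at
  most one further line passes through it.\<close>

lemma realised_flip:
  assumes "m < n" "p \<in> reg N" "lf m p = 0" "\<And>k. k \<noteq> m \<Longrightarrow> k \<in> N' \<longleftrightarrow> k \<in> N"
  shows "realised N'"
proof -
  have p: "p \<in> reg N'"
    unfolding reg_def mem_Collect_eq
  proof (intro allI impI)
    fix k assume "k < n"
    then show "sg N' k * lf k p \<ge> 0"
      using assms by (cases "k = m") (auto simp: reg_def sg_def)
  qed
  show ?thesis
  proof (cases "\<exists>k<n. k \<noteq> m \<and> lf k p = 0")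
    case True
    then obtain k where "k < n" "k \<noteq> m" "lf k p = 0" by blast
    then show ?thesis
      using realised_near[of m k p N'] p lf_ne_at_vertex[of m k _ p] assms by metis
  next
    case False
    have "(if m = 0 then 1 else 0) < n" "(if m = 0 then 1 else 0) \<noteq> m" using n3 by auto
    then obtain k where "k < n" "k \<noteq> m" by blast
    then show ?thesis
      using realised_near[of m k p N'] p False assms(1) by metis
  qed
qed

text \<open>Crossing line m realises the vector with the sign at m flipped. If m is next to no sign
  change, the flip isolates one sign and creates two more cyclic changes, which
  \<open>no_alternation\<close> forbids.\<close>

lemma met_in_ends:
  assumes "1 \<le> i" "i < j" "j \<le> n" "m < n" "p \<in> reg (cls {i..<j})" "lf m p = 0"
  shows "m \<in> ends i j"
proof (rule ccontr)
  assume "m \<notin> ends i j"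
  then have m: "m \<noteq> i - 1" "m \<noteq> i" "m \<noteq> j - 1" "m \<noteq> j mod n" by (auto simp: ends_def)
  define N where "N = cls {i..<j}"
  define N' where "N' = (if m \<in> N then N - {m} else insert m N)"
  have "realised N'"
    by (rule realised_flip[OF assms(4-6)]) (auto simp: N'_def N_def)
  \<comment> \<open>Comparing entries in pairs makes it irrelevant whether \<open>cls\<close> chose
    the interval or its complement.\<close>
  have same: "(u \<in> N' \<longleftrightarrow> v \<in> N') \<longleftrightarrow> ((u \<in> {i..<j} \<longleftrightarrow> v \<in> {i..<j}) \<longleftrightarrow> (u = m \<longleftrightarrow> v = m))"
    if "u < n" "v < n" for u v
    using that by (auto simp: N'_def N_def cls_def)
  have alt: False if "u < v" "v < w" "w < x" "x < n"
    "u \<in> N' \<longleftrightarrow> w \<in> N'" "v \<in> N' \<longleftrightarrow> x \<in> N'" "\<not> (u \<in> N' \<longleftrightarrow> v \<in> N')" for u v w x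
    using no_alternation[of N'] that \<open>realised N'\<close> by blast
  have jn: "j < n \<Longrightarrow> m \<noteq> j" using m by auto
  consider "i < m" "m < j - 1" | "1 \<le> m" "m < i - 1" | "m > j" | "m = 0"
    using m jn assms(4) by linarith
  then show False
  proof cases
    case 1
    then have "0 < i" "m < j - 1" "j - 1 < n" using assms by auto
    then show False using 1 assms(2,4)
      by (intro alt[of 0 i m "j - 1"]) (auto simp: same)
  next
    case 2
    then have "i - 1 < i" "i - 1 < n" "i < n" "0 < m" using assms by auto
    then show False using 2 assms(2,4)
      by (intro alt[of 0 m "i - 1" i]) (auto simp: same)
  next
    case 3
    then have "0 < j - 1" "j - 1 < j" "j < n" "j - 1 < n" "0 < i" "m < n" using assms m by auto
    then show False using 3 assms(2)
      by (intro alt[of 0 "j - 1" j m]) (auto simp: same)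
  next
    case 4
    then have "1 < i" "j < n" using m assms by (auto simp: le_less)
    then show False using 4 assms(2)
      by (intro alt[of 0 1 i j]) (auto simp: same)
  qed
qed

text \<open>A line at one sign change is cut by the two lines at the other, which gives the ends of
  its side. An index belonging to both changes takes one partner from each: \<open>i - 1\<close> and
  \<open>j mod n\<close> if \<open>j = i + 1\<close>, and \<open>n - 1\<close> and 1 if the index is
  0 with \<open>i = 1\<close> and \<open>j = n\<close>.\<close>

lemma ends_met:
  assumes "1 \<le> i" "i < j" "j \<le> n" "\<not> recedes {i..<j}" "m \<in> ends i j"
  shows "meets_in_side (L ` {..<n}) (L m) (reg (cls {i..<j}))"
proof -
  have side: ?thesis
    if kl: "m < n" "k < n" "l < n" "m \<noteq> k" "m \<noteq> l" "k \<noteq> l"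
      "m \<in> {i - 1, i} \<and> k \<in> {j - 1, j mod n} \<or> k \<in> {i - 1, i} \<and> m \<in> {j - 1, j mod n}"
      "m \<in> {i - 1, i} \<and> l \<in> {j - 1, j mod n} \<or> l \<in> {i - 1, i} \<and> m \<in> {j - 1, j mod n}" for k l
  proof -
    have *: "p \<in> reg (cls {i..<j})" if "lf m p = 0" "lf z p = 0" "m \<noteq> z"
      "m \<in> {i - 1, i} \<and> z \<in> {j - 1, j mod n} \<or> z \<in> {i - 1, i} \<and> m \<in> {j - 1, j mod n}" for z p
      using vertex_in_cls[of i j m z p] vertex_in_cls[of i j z m p] assms(1-4) that by metis
    obtain p q where "lf m p = 0" "lf k p = 0" "lf m q = 0" "lf l q = 0"
      using vertex_exists kl(1-5) by metis
    then show ?thesis using side_between_vertices[OF kl(1-6)] * kl by blast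
  qed
  have jn: "j mod n = (if j = n then 0 else j)" using assms by auto
  consider (first) "m = i - 1" "\<not> (i = 1 \<and> j = n)" | (corner) "m = 0" "i = 1" "j = n"
    | (single) "m = i" "j = i + 1" | (second) "m = i" "i + 1 < j"
    | (third) "m = j - 1" "i + 1 < j" | (last) "m = j mod n" "\<not> (i = 1 \<and> j = n)"
  proof -
    have "j = i + 1 \<or> i + 1 < j" using assms by auto
    then show thesis
      using assms(5) that jn unfolding ends_def by (cases "i = 1 \<and> j = n") auto
  qed
  then show ?thesis
  proof cases
    case first
    then show ?thesis
      by (intro side[of "j - 1" "j mod n"]) (use assms(1-3) n3 in \<open>auto simp: jn\<close>)
  next
    case corner
    then show ?thesis
      by (intro side[of "j - 1" "1"]) (use assms(1-3) n3 in \<open>auto simp: jn\<close>)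
  next
    case single
    then show ?thesis
      by (intro side[of "i - 1" "j mod n"]) (use assms(1-3) n3 jn in \<open>auto split: if_splits\<close>)
  next
    case second
    then show ?thesis
      by (intro side[of "j - 1" "j mod n"]) (use assms(1-3) n3 in \<open>auto simp: jn\<close>)
  next
    case third
    then show ?thesis
      by (intro side[of "i - 1" "i"]) (use assms(1-3) n3 in \<open>auto simp: jn\<close>)
  next
    case last
    then show ?thesis
      by (intro side[of "i - 1" "i"]) (use assms(1-3) n3 in \<open>auto simp: jn\<close>)
  qed
qed

lemma reg_in_gons:
  assumes "1 \<le> i" "i < j" "j \<le> n" "\<not> recedes {i..<j}"
  shows "reg (cls {i..<j}) \<in> gons (L ` {..<n}) m \<longleftrightarrow> card (ends i j) = m"
proof -
  let ?R = "reg (cls {i..<j})"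
  have ends: "ends i j \<subseteq> {..<n}" using assms n3 by (auto simp: ends_def)
  have "L x \<inter> ?R \<noteq> {} \<longleftrightarrow> x \<in> ends i j" if "x < n" for x
  proof
    assume "L x \<inter> ?R \<noteq> {}"
    then show "x \<in> ends i j" using met_in_ends[OF assms(1-3) that] mem_L that by blast
  next
    assume "x \<in> ends i j"
    then obtain p q where "L x \<inter> ?R = segment p q"
      using ends_met assms unfolding meets_in_side_def by blast
    moreover have "p \<in> segment p q" unfolding segment_iff by (rule exI[of _ 0]) simp
    ultimately show "L x \<inter> ?R \<noteq> {}" by blast
  qed
  then have met: "{l \<in> L ` {..<n}. l \<inter> ?R \<noteq> {}} = L ` ends i j"
    using ends by auto
  have card: "card (L ` ends i j) = card (ends i j)"
    using card_image inj_on_subset[OF inj ends] by blast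
  have bd: "?R \<in> bounded_regions (L ` {..<n})"
  proof -
    have "cls {i..<j} \<subseteq> {..<n}" using assms by (auto simp: cls_def)
    moreover have "\<not> recedes (cls {i..<j})" using assms(4) by (simp add: cls_def recedes_compl)
    ultimately show ?thesis
      using realised_cls[OF assms(1-3)] bounded_reg is_region_reg[OF inj]
      unfolding bounded_regions_def by blast
  qed
  have sides: "\<forall>l\<in>L ` {..<n}. l \<inter> ?R \<noteq> {} \<longrightarrow> meets_in_side (L ` {..<n}) l ?R"
  proof (intro ballI impI)
    fix l assume "l \<in> L ` {..<n}" "l \<inter> ?R \<noteq> {}"
    then have "l \<in> L ` ends i j" using met by blast
    then show "meets_in_side (L ` {..<n}) l ?R" using ends_met[OF assms] by blast
  qed
  show ?thesis
    unfolding gons_def mem_Collect_eq met card using bd sides by iprover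
qed

text \<open>The possible coincidences are \<open>i = j - 1\<close> and
  \<open>i - 1 = j mod n\<close>; both at once would force n = 2.\<close>

lemma card_ends:
  assumes "1 \<le> i" "i < j" "j \<le> n"
  shows "card (ends i j) = (if j = i + 1 \<or> i = 1 \<and> j = n then 3 else 4)"
proof -
  have jn: "j mod n = (if j = n then 0 else j)" using assms by auto
  show ?thesis
    using assms n3 unfolding ends_def jn by (auto simp: card_insert_if)
qed

subsection \<open>Separating indices and triangles\<close>

lemma d_next_mod: "i < n \<Longrightarrow> d i ((i + 1) mod n) > 0"
  using d_next[of i] d_last by (cases "i + 1 = n") auto

lemma lf_meet_eq:
  assumes "x < n" "y < n" "x \<noteq> y"
  shows "d x y * lf q (meet (L x) (L y)) = D x y q"
  using meet_in[of x y] d_times_lf d_ne assms by blast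

text \<open>A cyclic shift of three indices is an even permutation, so the corner on the last and
  the first line follows the same sign rule as the others.\<close>

lemma polygon_vertex_pos:
  assumes "j < n" "q < n" "q \<noteq> j" "q \<noteq> (j + 1) mod n"
  shows "lf q (meet (L j) (L ((j + 1) mod n))) > 0"
proof -
  have "D j ((j + 1) mod n) q > 0"
  proof (cases "j + 1 = n")
    case True
    then show ?thesis
      using D_pos[of 0 q j] D_permute(1,2)[where i = q and j = j and k = 0] assms by simp
  next
    case False
    then show ?thesis
      using D_pos_right[of j "j + 1" q] D_pos_left[of q j "j + 1"] assms by (cases "q < j") auto
  qed
  moreover have "j \<noteq> (j + 1) mod n" using assms(1) n3 by (cases "j + 1 = n") auto
  ultimately have "d j ((j + 1) mod n) * lf q (meet (L j) (L ((j + 1) mod n))) > 0"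
    using lf_meet_eq[of j "(j + 1) mod n" q] assms(1) by simp
  then show ?thesis using d_next_mod[OF assms(1)] by (simp add: zero_less_mult_iff)
qed

text \<open>The indices u, i, v are in cyclic order, which makes \<open>D u i v\<close> positive;
  exchanging the last two changes the sign.\<close>

lemma neighbours:
  assumes "i < n"
  defines "u \<equiv> (i + n - 1) mod n" and "v \<equiv> (i + 1) mod n"
  shows "u < n" "v < n" "u \<noteq> i" "v \<noteq> i" "u \<noteq> v" "d u i > 0" "d i v > 0" "D u v i < 0"
proof -
  have u: "u = (if i = 0 then n - 1 else i - 1)"
    using assms(1) n3 unfolding u_def by (auto simp: mod_if)
  have v: "v = (if i = n - 1 then 0 else i + 1)"
    using assms(1) n3 unfolding v_def by (auto simp: mod_if)
  show "u < n" "v < n" "u \<noteq> i" "v \<noteq> i" "u \<noteq> v"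
    using u v assms(1) n3 by (auto split: if_splits)
  show "d i v > 0" unfolding v_def using d_next_mod assms(1) by blast
  show "d u i > 0" unfolding u using d_next[of "i - 1"] d_last assms(1) by auto
  consider "i = 0" "u = n - 1" "v = 1" | "i = n - 1" "u = i - 1" "v = 0" | "u < i" "i < v"
    using u v assms(1) n3 by (auto split: if_splits)
  then show "D u v i < 0"
  proof cases
    case 1
    then show ?thesis
      using D_pos[of 0 1 "n - 1"] D_permute(5)[where i = 0 and j = 1 and k = "n - 1"] n3 by simp
  next
    case 2
    then show ?thesis
      using D_neg_between[of 0 u i] D_pos[of 0 u i] n3
        D_permute(3)[where i = 0 and j = u and k = i] by simp
  next
    case 3
    then show ?thesis using D_neg_between[of u i v] \<open>v < n\<close> by simp
  qed
qed

text \<open>The corners of the polygon off \<open>L i\<close> lie on its positive side. At the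
  vertex of the neighbours, \<open>d u v * lf i\<close> equals the negative number
  \<open>D u v i\<close>.\<close>

lemma separating_index_iff:
  assumes "i < n"
  shows "separating_index n L i \<longleftrightarrow> d ((i + n - 1) mod n) ((i + 1) mod n) > 0"
proof -
  define u v where "u = (i + n - 1) mod n" and "v = (i + 1) mod n"
  note uv = neighbours[OF assms, folded u_def v_def]
  have "d u v * lf i (meet (L u) (L v)) < 0"
    using lf_meet_eq[of u v i] uv by simp
  then have "lf i (meet (L u) (L v)) < 0 \<longleftrightarrow> d u v > 0"
    by (auto simp: mult_less_0_iff)
  moreover have "separating_index n L i \<longleftrightarrow> lf i (meet (L u) (L v)) < 0"
  proof
    assume "separating_index n L i"
    then obtain H H' where H: "H \<in> open_half_planes (L i)" "H' \<in> open_half_planes (L i)" "H \<noteq> H'"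
      and inH: "\<And>j. j < n \<Longrightarrow> j \<noteq> u \<Longrightarrow> j \<noteq> i \<Longrightarrow> meet (L j) (L ((j + 1) mod n)) \<in> H"
      and inH': "meet (L u) (L v) \<in> H'"
      unfolding separating_index_def u_def v_def by blast
    \<comment> \<open>One corner off \<open>L i\<close> suffices to identify H; the corner of
      \<open>L v\<close> and its successor exists even for n = 3.\<close>
    have "i \<noteq> (v + 1) mod n"
    proof
      assume "i = (v + 1) mod n"
      moreover have "v = (if i + 1 = n then 0 else i + 1)" using assms by (auto simp: v_def)
      ultimately show False using assms n3 by (cases "v + 1 = n") (auto split: if_splits)
    qed
    then have "meet (L v) (L ((v + 1) mod n)) \<in> {p. lf i p > 0}"
      using polygon_vertex_pos[of v i] uv assms by auto
    moreover have "meet (L v) (L ((v + 1) mod n)) \<in> H"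
      using inH uv by auto
    ultimately have "H' = {p. lf i p < 0}"
      using H unfolding open_half_planes_L[OF assms] by auto
    then show "lf i (meet (L u) (L v)) < 0" using inH' by blast
  next
    assume neg: "lf i (meet (L u) (L v)) < 0"
    show "separating_index n L i"
      unfolding separating_index_def u_def[symmetric] v_def[symmetric]
    proof (intro bexI conjI allI impI)
      fix j assume j: "j < n" "j \<notin> {u, i}"
      have "i \<noteq> (j + 1) mod n"
      proof
        assume i: "i = (j + 1) mod n"
        then have "u = j"
          unfolding u_def using j n3 by (cases "j + 1 = n") auto
        then show False using j by blast
      qed
      then show "meet (L j) (L ((j + 1) mod n)) \<in> {p. lf i p > 0}"
        using polygon_vertex_pos[of j i] j assms by auto
    next
      show "meet (L u) (L v) \<in> {p. lf i p < 0}" using neg by simp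
      then show "{p. lf i p > 0} \<noteq> {p. lf i p < 0}" by force
    qed (auto simp: open_half_planes_L[OF assms])
  qed
  ultimately show ?thesis unfolding u_def v_def by simp
qed

text \<open>Representatives omit 0, so the vector whose exceptional index is 0 is given by the
  complement.\<close>

definition singleton_class :: "nat \<Rightarrow> nat set" where
  "singleton_class i = (if i = 0 then {1..<n} else {i})"

text \<open>If \<open>d u v > 0\<close>, a direction with opposite signs at i and at both neighbours
  violates the three-term relation. If \<open>d u v < 0\<close>, the vertex of u and v and the
  vertex of u and i are corners of opposite regions, so both are realised.\<close>

lemma recedes_singleton_class:
  assumes "i < n"
  shows "recedes (singleton_class i) \<longleftrightarrow> \<not> separating_index n L i"
proof -
  define u v where "u = (i + n - 1) mod n" and "v = (i + 1) mod n"
  note uv = neighbours[OF assms, folded u_def v_def]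
  have sep: "separating_index n L i \<longleftrightarrow> d u v > 0"
    using separating_index_iff[OF assms] by (simp add: u_def v_def)
  have mem: "u \<in> singleton_class i \<longleftrightarrow> i \<notin> singleton_class i" "v \<in> singleton_class i \<longleftrightarrow> i \<notin> singleton_class i"
    using uv assms by (auto simp: singleton_class_def)
  have False if "recedes (singleton_class i)" "d u v > 0"
  proof -
    obtain w where w: "\<And>k. k < n \<Longrightarrow> sg (singleton_class i) k * lin k w > 0"
      using \<open>recedes (singleton_class i)\<close> unfolding recedes_def by blast
    have rel: "d i v * lin u w + d u i * lin v w = d u v * lin i w"
      using three_term_lin[where i = u and j = i and k = v] by simp
    have signs: "(if i \<in> singleton_class i then lin i w < 0 \<and> lin u w > 0 \<and> lin v w > 0
      else lin i w > 0 \<and> lin u w < 0 \<and> lin v w < 0)"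
      using w[OF assms] w[OF uv(1)] w[OF uv(2)] mem by (auto simp: sg_mult_pos)
    show False
    proof (cases "i \<in> singleton_class i")
      case True
      then have "d i v * lin u w > 0" "d u i * lin v w > 0" "d u v * lin i w < 0"
        using signs uv that(2) by (auto simp: mult_pos_neg)
      then show False using rel by linarith
    next
      case False
      then have "d i v * lin u w < 0" "d u i * lin v w < 0" "d u v * lin i w > 0"
        using signs uv that(2) by (auto simp: mult_pos_neg)
      then show False using rel by linarith
    qed
  qed
  moreover have "recedes (singleton_class i)" if "\<not> d u v > 0"
  proof -
    have neg: "d u v < 0" using that d_ne[OF uv(1,2,5)] by auto
    obtain p where p: "lf u p = 0" "lf v p = 0" using vertex_exists uv(1,2,5) by blast
    show ?thesis
    proof (cases "i = 0")
      case True
      then have u: "u = n - 1" and v: "v = 1" using n3 by (simp_all add: u_def v_def)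
      obtain q where q: "lf 0 q = 0" "lf (n - 1) q = 0"
        using vertex_exists[of 0 "n - 1"] n3 by auto
      have "d 0 (n - 1) < 0" "d 1 (n - 1) > 0"
        using d_last d_commute[of 0 "n - 1"] neg d_commute[of 1 "n - 1"] u v by simp_all
      then have "realised {1..<n}" "realised ({..<n} - {1..<n})"
        using vertex_reg[of 1 n 1 "n - 1" p] vertex_reg[of 1 n 0 "n - 1" q] p q u v n3 by simp_all
      then show ?thesis using recedes_if_both_realised True by (simp add: singleton_class_def)
    next
      case False
      have u: "u = i - 1" using False assms unfolding u_def by (auto simp: mod_if)
      obtain q where q: "lf u q = 0" "lf i q = 0" using vertex_exists[of u i] uv assms by auto
      have "realised {i..<i + 1}" "realised ({..<n} - {i..<i + 1})"
        using vertex_reg[of i "i + 1" u i q] vertex_reg[of i "i + 1" u v p] p q uv neg False assms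
        by (simp_all add: u v_def)
      moreover have "{i..<i + 1} = {i}" by auto
      ultimately show ?thesis using recedes_if_both_realised False by (simp add: singleton_class_def)
    qed
  qed
  ultimately show ?thesis using sep by blast
qed

subsection \<open>Counting\<close>

text \<open>Up to a positive factor, a direction with \<open>lin 0 w > 0\<close> is \<open>w\<^sub>0 + r z\<close> with \<open>w\<^sub>0\<close> normal and \<open>z\<close>
  parallel to \<open>L 0\<close>. The sign of \<open>lin k\<close> changes at one value of \<open>r\<close>, and these values are
  distinct.\<close>

lemma card_receding: "card {M. M \<subseteq> {..<n} \<and> 0 \<notin> M \<and> recedes M} = n"
proof -
  define w0 where "w0 = (a 0, b 0)"
  define z where "z = (- b 0, a 0)"
  define s where "s k = lin k w0 / d 0 k" for k
  define S where "S = s ` {1..<n}"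
  \<comment> \<open>On \<open>w0 - r z\<close> the form k equals \<open>d 0 k * (s k - r)\<close>:
    it vanishes at \<open>r = s k\<close> and, away from there, is negative iff
    \<open>d 0 k > 0\<close> agrees with \<open>s k < r\<close>.\<close>
  define \<phi> where "\<phi> X = {k \<in> {1..<n}. d 0 k > 0 \<longleftrightarrow> s k \<in> X}" for X
  have q: "lin 0 w0 > 0"
    using eqn[of 0] n3 unfolding w0_def lin_def has_equation_def
    by (simp add: sum_squares_gt_zero_iff)
  have z: "lin k z = d 0 k" for k
    by (simp add: z_def lin_def d_def)
  have d0: "d 0 k \<noteq> 0" if "k \<in> {1..<n}" for k
    using d_ne[of 0 k] that n3 by simp
  have inj_s: "inj_on s {1..<n}"
  proof (rule inj_onI, rule ccontr)
    fix k l assume kl: "k \<in> {1..<n}" "l \<in> {1..<n}" "s k = s l" "k \<noteq> l"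
    then have "lin k w0 * d 0 l = lin l w0 * d 0 k"
      using d0[of k] d0[of l] unfolding s_def by (simp add: field_simps)
    moreover have "lin k w0 * d 0 l - lin l w0 * d 0 k = lin 0 w0 * d k l"
      unfolding w0_def lin_def d_def fst_conv snd_conv by algebra
    ultimately show False using q d_ne[of k l] kl by auto
  qed
  have cell: "recedes (\<phi> {x \<in> S. x < r})" if "r \<notin> S" for r
    unfolding recedes_def
  proof (intro exI[of _ "(fst w0 + (- r) * fst z, snd w0 + (- r) * snd z)"] allI impI)
    fix k assume k: "k < n"
    show "sg (\<phi> {x \<in> S. x < r}) k * lin k (fst w0 + - r * fst z, snd w0 + - r * snd z) > 0"
    proof (cases "k = 0")
      case True
      have "0 \<notin> \<phi> {x \<in> S. x < r}" by (simp add: \<phi>_def)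
      then show ?thesis using q unfolding True lin_add z by (simp add: sg_def d_def)
    next
      case False
      then have k': "k \<in> {1..<n}" using k by simp
      then have "s k \<in> S" by (simp add: S_def)
      then have "s k \<noteq> r" using that by blast
      have eq: "lin k (fst w0 + - r * fst z, snd w0 + - r * snd z) = d 0 k * (s k - r)"
        unfolding lin_add z using d0[OF k'] by (simp add: s_def field_simps)
      have "k \<in> \<phi> {x \<in> S. x < r} \<longleftrightarrow> (d 0 k > 0 \<longleftrightarrow> s k < r)"
        using k' \<open>s k \<in> S\<close> by (simp add: \<phi>_def)
      then show ?thesis
        unfolding eq sg_mult_pos using d0[OF k'] \<open>s k \<noteq> r\<close>
        by (auto simp: zero_less_mult_iff mult_less_0_iff)
    qed
  qed
  have eq: "{M. M \<subseteq> {..<n} \<and> 0 \<notin> M \<and> recedes M} = \<phi> ` {{x \<in> S. x < r} |r. r \<notin> S}"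
  proof (intro subset_antisym subsetI)
    fix M assume "M \<in> {M. M \<subseteq> {..<n} \<and> 0 \<notin> M \<and> recedes M}"
    then obtain w where M: "M \<subseteq> {..<n}" "0 \<notin> M"
      and w: "\<And>k. k < n \<Longrightarrow> sg M k * lin k w > 0"
      unfolding recedes_def by blast
    \<comment> \<open>This ratio recovers r from any positive multiple of
      \<open>w0 - r z\<close>.\<close>
    define r where "r = (b 0 * fst w - a 0 * snd w) / lin 0 w"
    have w0: "lin 0 w > 0" using w[of 0] n3 M by (simp add: sg_def)
    have lin: "lin k w * lin 0 w0 = lin 0 w * (d 0 k * (s k - r))" if "k \<in> {1..<n}" for k
    proof -
      have "lin 0 w * (d 0 k * (s k - r)) = lin 0 w * lin k w0 - d 0 k * (b 0 * fst w - a 0 * snd w)"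
        using w0 d0[OF that] by (simp add: s_def r_def field_simps)
      also have "\<dots> = lin k w * lin 0 w0"
        unfolding w0_def lin_def d_def fst_conv snd_conv by algebra
      finally show ?thesis by simp
    qed
    have sgn: "0 < lin k w \<longleftrightarrow> 0 < d 0 k * (s k - r)" "lin k w < 0 \<longleftrightarrow> d 0 k * (s k - r) < 0"
      if "k \<in> {1..<n}" for k
    proof -
      have g: "0 < x \<longleftrightarrow> 0 < x * y" "x < 0 \<longleftrightarrow> x * y < 0" if "0 < y" for x y :: 'a
        using that by (simp_all add: zero_less_mult_iff mult_less_0_iff)
      show "0 < lin k w \<longleftrightarrow> 0 < d 0 k * (s k - r)" "lin k w < 0 \<longleftrightarrow> d 0 k * (s k - r) < 0"
        unfolding g[OF q, of "lin k w"] g[OF w0, of "d 0 k * (s k - r)"] lin[OF that]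
        by (simp_all only: mult.commute)
    qed
    have mem: "k \<in> M \<longleftrightarrow> (d 0 k > 0 \<longleftrightarrow> s k < r)" and ne: "s k \<noteq> r" if k: "k \<in> {1..<n}" for k
    proof -
      have "sg M k * lin k w > 0" using w k by simp
      then have "if k \<in> M then d 0 k * (s k - r) < 0 else d 0 k * (s k - r) > 0"
        using sgn[OF k] by (auto simp only: sg_mult_pos split: if_splits)
      then show "k \<in> M \<longleftrightarrow> (d 0 k > 0 \<longleftrightarrow> s k < r)" "s k \<noteq> r"
        by (auto simp: zero_less_mult_iff mult_less_0_iff split: if_splits)
    qed
    have "M = \<phi> {x \<in> S. x < r}"
    proof (rule set_eqI)
      fix k
      show "k \<in> M \<longleftrightarrow> k \<in> \<phi> {x \<in> S. x < r}"
      proof (cases "k \<in> {1..<n}")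
        case True
        then show ?thesis using mem[OF True] by (simp add: \<phi>_def S_def)
      next
        case False
        then have "k = 0 \<or> k \<ge> n" by auto
        then show ?thesis using M by (auto simp: \<phi>_def)
      qed
    qed
    moreover have "r \<notin> S" using ne unfolding S_def by blast
    ultimately show "M \<in> \<phi> ` {{x \<in> S. x < r} |r. r \<notin> S}" by blast
  next
    fix M assume "M \<in> \<phi> ` {{x \<in> S. x < r} |r. r \<notin> S}"
    then obtain r where r: "r \<notin> S" "M = \<phi> {x \<in> S. x < r}" by blast
    moreover have "\<phi> X \<subseteq> {..<n}" "0 \<notin> \<phi> X" for X by (auto simp: \<phi>_def)
    ultimately show "M \<in> {M. M \<subseteq> {..<n} \<and> 0 \<notin> M \<and> recedes M}" using cell by simp
  qed
  have "inj_on \<phi> (Pow S)"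
  proof (rule inj_onI)
    fix X Y assume XY: "X \<in> Pow S" "Y \<in> Pow S" "\<phi> X = \<phi> Y"
    have "s k \<in> X \<longleftrightarrow> s k \<in> Y" if "k \<in> {1..<n}" for k
    proof -
      have "k \<in> \<phi> X \<longleftrightarrow> k \<in> \<phi> Y" using XY(3) by simp
      then show ?thesis using that by (auto simp: \<phi>_def)
    qed
    then show "X = Y" using XY(1,2) by (auto simp: S_def)
  qed
  then have inj: "inj_on \<phi> {{x \<in> S. x < r} |r. r \<notin> S}"
    by (rule inj_on_subset) auto
  have "finite S" by (simp add: S_def)
  then have "card {{x \<in> S. x < r} |r. r \<notin> S} = card S + 1"
    by (rule card_cuts)
  also have "card S = n - 1" unfolding S_def using card_image[OF inj_s] by simp
  also have "n - 1 + 1 = n" using n3 by simp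
  finally show ?thesis unfolding eq card_image[OF inj] .
qed

section \<open>Bounded classes and bounded regions\<close>

definition interval_classes :: "nat set set" where
  "interval_classes = (\<lambda>(i, j). {i..<j}) ` {(i, j). 1 \<le> i \<and> i < j \<and> j \<le> n}"

lemma card_interval_classes: "card interval_classes = n choose 2"
proof -
  have "inj_on (\<lambda>(i, j). {i..<j}) {(i, j). 1 \<le> i \<and> i < j \<and> j \<le> n}"
    by (auto simp: inj_on_def atLeastLessThan_inj)
  then show ?thesis unfolding interval_classes_def using card_pairs by (simp add: card_image)
qed

lemma finite_interval_classes: "finite interval_classes"
  by (rule finite_subset[of _ "Pow {..<n}"]) (auto simp: interval_classes_def)

text \<open>The class of the polygon itself is the empty set, which is no interval class, and is
  therefore left out.\<close>

definition bounded_classes :: "nat set set" where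
  "bounded_classes = {M \<in> interval_classes. \<not> recedes M}"

text \<open>A nonempty receding class is an interval, and the empty one does not recede because the
  polygon is bounded; hence all n receding classes are among the interval classes.\<close>

lemma card_bounded_classes: "card bounded_classes + n = n choose 2"
proof -
  have "{M. M \<subseteq> {..<n} \<and> 0 \<notin> M \<and> recedes M} = {M \<in> interval_classes. recedes M}"
  proof (intro subset_antisym subsetI)
    fix M assume M: "M \<in> {M. M \<subseteq> {..<n} \<and> 0 \<notin> M \<and> recedes M}"
    then have "M \<noteq> {}" using not_recedes_empty by auto
    then obtain i j where "1 \<le> i" "i < j" "j \<le> n" "M = {i..<j}"
      using interval_class M by blast
    then show "M \<in> {M \<in> interval_classes. recedes M}"
      using M by (auto simp: interval_classes_def)
  qed (auto simp: interval_classes_def)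
  then have "card {M \<in> interval_classes. recedes M} = n" using card_receding by simp
  moreover have "card interval_classes = card bounded_classes + card {M \<in> interval_classes. recedes M}"
    unfolding bounded_classes_def
    by (subst card_Un_disjoint[symmetric]) (auto simp: finite_interval_classes intro: arg_cong[of _ _ card])
  ultimately show ?thesis using card_interval_classes by simp
qed

lemma realised_empty: "realised {}"
proof -
  obtain p where p: "lf 0 p = 0" "lf 1 p = 0" using vertex_exists[of 0 1] n3 by auto
  have pos: "lf q p > 0" if "q < n" "q \<noteq> 0" "q \<noteq> 1" for q
  proof -
    have "d 0 1 * lf q p > 0"
      using d_times_lf[OF p, of q] D_pos[of 0 1 q] that by simp
    then show ?thesis using d_next[of 0] n3 by (simp add: zero_less_mult_iff)
  qed
  have "sg {} q * lf q p \<ge> 0" if "q < n" for q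
    using pos[OF that] p by (cases "q = 0 \<or> q = 1") (auto simp: sg_def less_imp_le)
  then have "p \<in> reg {}" by (simp add: reg_def)
  moreover have "lf q p \<noteq> 0" if "q < n" "q \<noteq> 0" "q \<noteq> 1" for q
    using pos[OF that] by simp
  ultimately show ?thesis using realised_near[of 0 1 p "{}"] n3 by force
qed

lemma bounded_regions_eq:
  "bounded_regions (L ` {..<n}) = insert (reg {}) ((\<lambda>M. reg (cls M)) ` bounded_classes)"
proof (intro subset_antisym subsetI)
  fix R assume "R \<in> bounded_regions (L ` {..<n})"
  then have R: "is_region (L ` {..<n}) R" "bounded_set R" by (simp_all add: bounded_regions_def)
  obtain N where N: "N \<subseteq> {..<n}" "realised N" "R = reg N"
    using R(1) unfolding is_region_reg[OF inj] by (elim exE conjE)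
  then have nrN: "\<not> recedes N" using R(2) bounded_reg by simp
  show "R \<in> insert (reg {}) ((\<lambda>M. reg (cls M)) ` bounded_classes)"
  proof (cases "N = {}")
    case True
    then show ?thesis using N by simp
  next
    case False
    \<comment> \<open>Of the two opposite vectors the one omitting 0 represents the class;
      \<open>cls\<close> returns N because in a bounded class only one of them is realised.\<close>
    define M where "M = (if 0 \<in> N then {..<n} - N else N)"
    have MN: "{..<n} - M = N \<or> M = N" using N(1) by (auto simp: M_def)
    have nr: "\<not> recedes M" using nrN by (simp add: M_def recedes_compl)
    \<comment> \<open>All signs negative would be opposite to the polygon, which would then be
      unbounded.\<close>
    have N0: "N \<noteq> {..<n}"
      using recedes_if_both_realised[of "{}"] realised_empty not_recedes_empty N by auto
    have "cls M = N"
    proof (cases "0 \<in> N")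
      case True
      then have M: "M = {..<n} - N" "{..<n} - M = N" using N(1) by (auto simp: M_def)
      then have "\<not> realised M" using recedes_if_both_realised[of N] N nrN by auto
      then show ?thesis using M by (simp add: cls_def)
    next
      case False
      then show ?thesis using N by (simp add: cls_def M_def)
    qed
    moreover have "M \<in> bounded_classes"
    proof -
      have M: "M \<subseteq> {..<n}" "0 \<notin> M" "M \<noteq> {}" using N(1) False N0 by (auto simp: M_def)
      have "realised M \<or> realised ({..<n} - M) \<or> recedes M" using N MN by auto
      then obtain i j where "1 \<le> i" "i < j" "j \<le> n" "M = {i..<j}"
        using interval_class M by blast
      then show ?thesis using nr by (auto simp: bounded_classes_def interval_classes_def)
    qed
    ultimately show ?thesis using N by blast
  qed
next
  fix R assume "R \<in> insert (reg {}) ((\<lambda>M. reg (cls M)) ` bounded_classes)"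
  then obtain N where "N \<subseteq> {..<n}" "realised N" "\<not> recedes N" "R = reg N"
  proof
    assume "R = reg {}"
    then show thesis using that[of "{}"] realised_empty not_recedes_empty by blast
  next
    assume "R \<in> (\<lambda>M. reg (cls M)) ` bounded_classes"
    then obtain M where M: "M \<in> bounded_classes" "R = reg (cls M)" by blast
    then obtain i j where ij: "1 \<le> i" "i < j" "j \<le> n" "M = {i..<j}" "\<not> recedes M"
      by (auto simp: bounded_classes_def interval_classes_def)
    have "cls M \<subseteq> {..<n}" "realised (cls M)" "\<not> recedes (cls M)"
      using realised_cls[OF ij(1-3)] ij by (auto simp: cls_def recedes_compl)
    then show thesis using that M by blast
  qed
  then have "\<exists>N\<subseteq>{..<n}. realised N \<and> R = reg N" "bounded_set R"
    using bounded_reg by auto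
  then show "R \<in> bounded_regions (L ` {..<n})"
    unfolding bounded_regions_def is_region_reg[OF inj] by simp
qed

lemma bounded_classesE:
  assumes "M \<in> bounded_classes"
  obtains i j where "1 \<le> i" "i < j" "j \<le> n" "M = {i..<j}" "\<not> recedes {i..<j}"
  using assms by (auto simp: bounded_classes_def interval_classes_def)

text \<open>Representatives omit 0, so membership of 0 in \<open>cls M\<close> tells whether M or
  its complement was chosen. The empty class is included to separate the polygon from all other
  regions.\<close>

lemma inj_on_reg_cls: "inj_on (\<lambda>M. reg (cls M)) (insert {} bounded_classes)"
proof (rule inj_onI)
  fix M M' assume M: "M \<in> insert {} bounded_classes" "M' \<in> insert {} bounded_classes"
    and eq: "reg (cls M) = reg (cls M')"
  have *: "K \<subseteq> {..<n} \<and> 0 \<notin> K \<and> realised (cls K)" if "K \<in> insert {} bounded_classes" for K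
    using that
  proof
    assume "K = {}"
    then show ?thesis using realised_empty by (simp add: cls_def)
  next
    assume "K \<in> bounded_classes"
    then obtain i j where "1 \<le> i" "i < j" "j \<le> n" "K = {i..<j}" by (rule bounded_classesE)
    then show ?thesis using realised_cls by auto
  qed
  have cl: "cls K \<subseteq> {..<n} \<and> (0 \<in> cls K \<longrightarrow> cls K = {..<n} - K) \<and> (0 \<notin> cls K \<longrightarrow> cls K = K)"
    if "K \<in> insert {} bounded_classes" for K
  proof -
    have "0 \<in> {..<n} - K" using *[OF that] n3 by auto
    then show ?thesis using *[OF that] by (auto simp: cls_def)
  qed
  have "cls M = cls M'"
    using reg_inject[of "cls M" "cls M'"] *[OF M(1)] cl[OF M(1)] cl[OF M(2)] eq by blast
  then show "M = M'" using *[OF M(1)] *[OF M(2)] cl[OF M(1)] cl[OF M(2)]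
    by (metis double_diff subset_refl)
qed

lemma cls_empty: "cls {} = {}"
  using realised_empty by (simp add: cls_def)

section \<open>Triangles, quadrilaterals and the n-gon\<close>

definition triangle_classes :: "nat set set" where
  "triangle_classes = {M \<in> bounded_classes. \<exists>i<n. M = singleton_class i}"

lemma reg_cls_in_gons:
  assumes "M \<in> bounded_classes"
  shows "reg (cls M) \<in> gons (L ` {..<n}) m \<longleftrightarrow> m = (if M \<in> triangle_classes then 3 else 4)"
proof -
  obtain i j where ij: "1 \<le> i" "i < j" "j \<le> n" "M = {i..<j}" "\<not> recedes {i..<j}"
    using assms by (rule bounded_classesE)
  have "M \<in> triangle_classes \<longleftrightarrow> j = i + 1 \<or> i = 1 \<and> j = n"
  proof
    assume "M \<in> triangle_classes"
    then obtain l where l: "l < n" "{i..<j} = singleton_class l"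
      by (auto simp: triangle_classes_def ij(4))
    show "j = i + 1 \<or> i = 1 \<and> j = n"
    proof (cases "l = 0")
      case True
      then have "{i..<j} = {1..<n}" using l by (simp add: singleton_class_def)
      then show ?thesis using ij n3 atLeastLessThan_eq_iff[of i j 1 n] by simp
    next
      case False
      then have "{i..<j} = {l..<l + 1}" using l by (auto simp: singleton_class_def)
      then have "i = l" "j = l + 1" using ij atLeastLessThan_eq_iff[of i j l "l + 1"] by simp_all
      then show ?thesis by simp
    qed
  next
    assume "j = i + 1 \<or> i = 1 \<and> j = n"
    then have "M = singleton_class i \<and> i < n \<or> M = singleton_class 0 \<and> 0 < n"
      using ij by (auto simp: singleton_class_def)
    then have "\<exists>l<n. M = singleton_class l" by blast
    then show "M \<in> triangle_classes"
      using assms by (simp add: triangle_classes_def)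
  qed
  then show ?thesis unfolding ij(4) using reg_in_gons[OF ij(1-3,5)] card_ends[OF ij(1-3)] by auto
qed

lemma gons_minus_polygon:
  "gons (L ` {..<n}) m - {reg {}}
    = (\<lambda>M. reg (cls M)) ` {M \<in> bounded_classes. m = (if M \<in> triangle_classes then 3 else 4)}"
proof -
  have ne: "reg (cls M) \<noteq> reg {}" if "M \<in> bounded_classes" for M
  proof
    assume "reg (cls M) = reg {}"
    then have "M = {}"
      using inj_on_reg_cls that by (auto simp: inj_on_def cls_empty)
    then show False using that by (auto simp: bounded_classes_def interval_classes_def)
  qed
  have "gons (L ` {..<n}) m \<subseteq> bounded_regions (L ` {..<n})"
    by (auto simp: gons_def)
  then have sub: "\<exists>M\<in>bounded_classes. R = reg (cls M)"
    if "R \<in> gons (L ` {..<n}) m" "R \<noteq> reg {}" for R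
    using that unfolding bounded_regions_eq by blast
  show ?thesis
  proof (intro subset_antisym subsetI)
    fix R assume R: "R \<in> gons (L ` {..<n}) m - {reg {}}"
    then obtain M where M: "M \<in> bounded_classes" "R = reg (cls M)" using sub by blast
    then have "m = (if M \<in> triangle_classes then 3 else 4)"
      using R reg_cls_in_gons[OF M(1)] by blast
    then show "R \<in> (\<lambda>M. reg (cls M)) ` {M \<in> bounded_classes. m = (if M \<in> triangle_classes then 3 else 4)}"
      using M by blast
  next
    fix R assume "R \<in> (\<lambda>M. reg (cls M)) ` {M \<in> bounded_classes. m = (if M \<in> triangle_classes then 3 else 4)}"
    then obtain M where M: "M \<in> bounded_classes" "R = reg (cls M)"
      "m = (if M \<in> triangle_classes then 3 else 4)" by blast
    then show "R \<in> gons (L ` {..<n}) m - {reg {}}"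
      using ne[OF M(1)] reg_cls_in_gons[OF M(1)] by blast
  qed
qed

lemma card_gons_minus_polygon:
  "card (gons (L ` {..<n}) m - {reg {}})
    = card {M \<in> bounded_classes. m = (if M \<in> triangle_classes then 3 else 4)}"
  unfolding gons_minus_polygon
  by (rule card_image) (rule inj_on_subset[OF inj_on_reg_cls], blast)

lemma card_triangle_classes: "card triangle_classes = card {i. i < n \<and> separating_index n L i}"
proof -
  have inj': "inj_on singleton_class {..<n}"
  proof (rule inj_onI)
    fix x y assume xy: "x \<in> {..<n}" "y \<in> {..<n}" "singleton_class x = singleton_class y"
    \<comment> \<open>The class of index 0 could collide with another one only if n were 2.\<close>
    have 0: "{1..<n} \<noteq> {k}" for k
    proof
      assume "{1..<n} = {k}"
      then have "card {1..<n} = 1" by simp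
      then show False using n3 by simp
    qed
    show "x = y" using xy 0[of x] 0[of y] unfolding singleton_class_def by (auto split: if_splits)
  qed
  have eq: "triangle_classes = singleton_class ` {i. i < n \<and> separating_index n L i}"
  proof (intro subset_antisym subsetI)
    fix M assume "M \<in> triangle_classes"
    then show "M \<in> singleton_class ` {i. i < n \<and> separating_index n L i}"
      using recedes_singleton_class by (auto simp: triangle_classes_def bounded_classes_def)
  next
    fix M assume "M \<in> singleton_class ` {i. i < n \<and> separating_index n L i}"
    then obtain i where i: "i < n" "separating_index n L i" "M = singleton_class i" by blast
    have "M = (\<lambda>(i, j). {i..<j}) (if i = 0 then (1, n) else (i, i + 1))"
      by (auto simp: i(3) singleton_class_def)
    moreover have "(if i = 0 then (1, n) else (i, i + 1)) \<in> {(i, j). 1 \<le> i \<and> i < j \<and> j \<le> n}"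
      using i n3 by auto
    ultimately have "M \<in> interval_classes" unfolding interval_classes_def by (rule image_eqI)
    then show "M \<in> triangle_classes"
      using i recedes_singleton_class by (auto simp: triangle_classes_def bounded_classes_def)
  qed
  have "inj_on singleton_class {i. i < n \<and> separating_index n L i}"
    by (rule inj_on_subset[OF inj']) auto
  then show ?thesis unfolding eq by (rule card_image)
qed

text \<open>With three lines the successor of i is followed by its predecessor, so
  \<open>d u v\<close> is minus a positive number.\<close>

lemma separating_count_3: "n = 3 \<Longrightarrow> {i. i < n \<and> separating_index n L i} = {}"
proof -
  assume n: "n = 3"
  have pos: "d 0 1 > 0" "d 1 2 > 0" "d 2 0 > 0"
    using d_next[of 0] d_next[of 1] d_last n by (simp_all add: numeral_2_eq_2)
  moreover have "d 1 0 = - d 0 1" "d 2 1 = - d 1 2" "d 0 2 = - d 2 0" by (rule d_commute)+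
  moreover have "separating_index n L 0 \<longleftrightarrow> d 2 1 > 0" "separating_index n L 1 \<longleftrightarrow> d 0 2 > 0"
    "separating_index n L 2 \<longleftrightarrow> d 1 0 > 0"
    using separating_index_iff[of 0] separating_index_iff[of 1] separating_index_iff[of 2] n by (simp_all del: One_nat_def) simp
  ultimately have "\<not> separating_index n L 0" "\<not> separating_index n L 1" "\<not> separating_index n L 2"
    by simp_all
  moreover have "i < n \<Longrightarrow> i = 0 \<or> i = 1 \<or> i = 2" for i using n by auto
  ultimately show ?thesis by blast
qed

text \<open>Opposite indices have the same neighbours in reverse order, so exactly one index of each
  opposite pair separates.\<close>

lemma separating_count_4:
  assumes "n = 4"
  shows "card {i. i < n \<and> separating_index n L i} = 2"
proof -
  have "{i. i < n \<and> separating_index n L i}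
    = {if d 0 2 > 0 then 1 else 3, if d 1 3 > 0 then 2 else 0}"
  proof (intro set_eqI)
    fix i :: nat
    have "i < 4 \<longleftrightarrow> i = 0 \<or> i = 1 \<or> i = 2 \<or> i = 3" by auto
    moreover have "d 3 1 = - d 1 3" "d 2 0 = - d 0 2" by (rule d_commute)+
    moreover have "d 0 2 \<noteq> 0" "d 1 3 \<noteq> 0" using d_ne assms by auto
    moreover have "d 0 2 > 0 \<longleftrightarrow> separating_index n L 1" "d 1 3 > 0 \<longleftrightarrow> separating_index n L 2"
      "d 2 0 > 0 \<longleftrightarrow> separating_index n L 3" "d 3 1 > 0 \<longleftrightarrow> separating_index n L 0"
      using separating_index_iff[of 1] separating_index_iff[of 2] separating_index_iff[of 3]
        separating_index_iff[of 0] assms by (simp_all del: One_nat_def)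
    ultimately show "i \<in> {i. i < n \<and> separating_index n L i} \<longleftrightarrow>
      i \<in> {if d 0 2 > 0 then 1 else 3, if d 1 3 > 0 then 2 else 0}"
      using assms by auto
  qed
  then show ?thesis by auto
qed

theorem gon_counts:
  fixes k :: nat
  assumes k: "k = card {i. i < n \<and> separating_index n L i}"
    and P: "reg {} \<in> gons (L ` {..<n}) n"
  shows "gons (L ` {..<n}) n = {reg {}}
    \<and> card (gons (L ` {..<n}) 3 - {reg {}}) = k
    \<and> int (card (gons (L ` {..<n}) 4 - {reg {}})) = int ((n - 1) choose 2) - int k - 1"
proof -
  have fin: "finite bounded_classes"
    using finite_interval_classes by (simp add: bounded_classes_def)
  have tri: "{M \<in> bounded_classes. 3 = (if M \<in> triangle_classes then 3 else 4 :: nat)} = triangle_classes"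
    by (auto simp: triangle_classes_def)
  have quad: "{M \<in> bounded_classes. 4 = (if M \<in> triangle_classes then 3 else 4 :: nat)}
    = bounded_classes - triangle_classes" by auto
  have 3: "card (gons (L ` {..<n}) 3 - {reg {}}) = k"
    unfolding card_gons_minus_polygon tri k by (rule card_triangle_classes)
  have sub: "triangle_classes \<subseteq> bounded_classes" by (auto simp: triangle_classes_def)
  \<comment> \<open>By Pascal's rule, removing the n receding classes leaves one less than
    \<open>(n - 1) choose 2\<close>; the missing one is the polygon.\<close>
  have "n choose 2 = ((n - 1) choose 2) + (n - 1)"
    using n3 by (cases n) (auto simp: numeral_2_eq_2)
  then have cb: "int (card bounded_classes) = int ((n - 1) choose 2) - 1"
    using card_bounded_classes n3 by simp
  have "card (bounded_classes - triangle_classes) = card bounded_classes - card triangle_classes"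
    "card triangle_classes \<le> card bounded_classes"
    using fin sub by (auto intro: card_Diff_subset card_mono finite_subset)
  then have 4: "int (card (gons (L ` {..<n}) 4 - {reg {}})) = int ((n - 1) choose 2) - int k - 1"
    unfolding card_gons_minus_polygon quad using cb k card_triangle_classes by simp
  have finr: "finite (gons (L ` {..<n}) m - {reg {}})" for m
    unfolding gons_minus_polygon using fin by simp
  \<comment> \<open>The triangle or quadrilateral count excludes a second n-gon for n = 3 or 4
    (there \<open>3 - 2 - 1 = 0\<close>); for larger n, all other bounded regions have too few
    sides.\<close>
  consider "n = 3" | "n = 4" | "n > 4" using n3 by linarith
  then have "gons (L ` {..<n}) n - {reg {}} = {}"
  proof cases
    case 1
    then have "k = 0" using k separating_count_3 by simp
    then show ?thesis using 3 1 finr[of 3] by simp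
  next
    case 2
    then have "k = 2" using k separating_count_4 by simp
    moreover have "(3::nat) choose 2 = 3" by (simp add: numeral_eq_Suc)
    ultimately have "card (gons (L ` {..<n}) 4 - {reg {}}) = 0"
      using 4 2 by simp
    then show ?thesis using 2 finr[of 4] by simp
  next
    case 3
    then show ?thesis unfolding gons_minus_polygon by auto
  qed
  then show ?thesis using P 3 4 by blast
qed

end

section \<open>From the gonality to positive determinants\<close>

context oriented_lines
begin

text \<open>With a common point, proportional normals give proportional equations, so the lines
  would coincide.\<close>

lemma d_nonzero:
  assumes "i < n" "j < n" "L i \<noteq> L j" "L i \<inter> L j \<noteq> {}"
  shows "d i j \<noteq> 0"
proof
  assume "d i j = 0"
  obtain r where r: "r \<in> L i" "r \<in> L j" using assms(4) by blast
  have sub: "L x \<subseteq> L y" if "x < n" "y < n" "d x y = 0" "r \<in> L x" "r \<in> L y" for x y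
  proof
    fix p assume "p \<in> L x"
    then have "lf x p = 0" "lf x r = 0" "lf y r = 0" using mem_L that by auto
    then have "a x * lf y p = 0" "b x * lf y p = 0"
      using that(3) unfolding lf_def d_def by algebra+
    moreover have "a x \<noteq> 0 \<or> b x \<noteq> 0" using eqn[OF that(1)] by (simp add: has_equation_def)
    ultimately show "p \<in> L y" using mem_L that(2) by auto
  qed
  have "d j i = 0" using \<open>d i j = 0\<close> by (simp add: d_def)
  then show False using sub[of i j] sub[of j i] r assms \<open>d i j = 0\<close> by blast
qed

text \<open>The vector \<open>t - s\<close> is a positive multiple of \<open>(b i, - a i)\<close>, the normal rotated clockwise,
  and \<open>lf j\<close> does not increase from \<open>s\<close> to \<open>t\<close>.\<close>

lemma d_nonneg_of_side:
  assumes "i < n" "lf i s = 0" "lf i t = 0" "lf j t = 0" "lf j s \<ge> 0" "s \<noteq> t"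
    "weakly_left_of s t p" "lf i p > 0"
  shows "d i j \<ge> 0"
proof -
  define Q where "Q = a i * a i + b i * b i"
  \<comment> \<open>\<open>t - s\<close> is \<open>\<mu> / Q\<close> times
    \<open>(b i, - a i)\<close>, and the position of p to the left determines the sign of this
    factor.\<close>
  define \<mu> where "\<mu> = b i * (fst t - fst s) - a i * (snd t - snd s)"
  have "a i \<noteq> 0 \<or> b i \<noteq> 0" using eqn[OF assms(1)] by (simp add: has_equation_def)
  then have Q: "Q > 0" by (simp add: Q_def sum_squares_gt_zero_iff)
  have "\<mu> * lf i p
    = Q * ((fst t - fst s) * (snd p - snd s) - (snd t - snd s) * (fst p - fst s))"
    using assms(2,3) unfolding \<mu>_def Q_def lf_def by algebra
  moreover have "(fst t - fst s) * (snd p - snd s) - (snd t - snd s) * (fst p - fst s) \<ge> 0"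
    using assms(7) by (simp add: weakly_left_of_def)
  ultimately have "\<mu> * lf i p \<ge> 0" using Q by simp
  then have "\<mu> \<ge> 0" using assms(8) by (simp add: zero_le_mult_iff)
  moreover have "Q * (fst t - fst s) = \<mu> * b i" "Q * (snd t - snd s) = - \<mu> * a i"
    using assms(2,3) unfolding \<mu>_def Q_def lf_def by algebra+
  then have "\<mu> \<noteq> 0" using Q assms(6) by (auto simp: prod_eq_iff)
  ultimately have "\<mu> > 0" by simp
  have "\<mu> * d i j = Q * lf j s"
    using assms(2-4) unfolding \<mu>_def Q_def lf_def d_def by algebra
  also have "Q * lf j s \<ge> 0" using Q assms(5) by simp
  finally show ?thesis using \<open>\<mu> > 0\<close> by (simp add: zero_le_mult_iff)
qed

end

text \<open>The signs of the region are absorbed into the coefficients, so that P is where all forms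
  are nonnegative. The traversal gives weak signs; absence of parallel and of concurrent lines makes
  them strict.\<close>

lemma polygon_lines_of_gonality:
  fixes L :: "nat \<Rightarrow> 'a::linordered_field pt set"
  assumes n: "n \<ge> 3" and inj: "inj_on L {..<n}" and arr: "line_arrangement (L ` {..<n})"
    and gon: "gonality n L P"
  obtains a b c where "polygon_lines n a b c L" "P = oriented_lines.reg n a b c {}"
proof -
  have "is_region (L ` {..<n}) P" and bd: "bounded_set P"
    using gon by (simp_all add: gonality_def bounded_regions_def)
  then obtain a' b' c' e x0 y0 where
    eqs: "\<forall>l\<in>L ` {..<n}. has_equation l (a' l) (b' l) (c' l) \<and> e l \<in> {1, -1}"
    and P: "P = {(x, y). \<forall>l\<in>L ` {..<n}. e l * (a' l * x + b' l * y - c' l) \<ge> 0}"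
    and xy: "\<forall>l\<in>L ` {..<n}. e l * (a' l * x0 + b' l * y0 - c' l) > 0"
    unfolding is_region_def by (elim exE conjE) (rule that)
  define a where "a i = e (L i) * a' (L i)" for i
  define b where "b i = e (L i) * b' (L i)" for i
  define c where "c i = e (L i) * c' (L i)" for i
  have eqn: "has_equation (L i) (a i) (b i) (c i)" if i: "i < n" for i
  proof -
    have h: "has_equation (L i) (a' (L i)) (b' (L i)) (c' (L i))" "e (L i) = 1 \<or> e (L i) = - 1"
      using eqs i by auto
    show ?thesis
      using h(2)
    proof
      assume "e (L i) = 1"
      then show ?thesis using h(1) by (simp add: a_def b_def c_def)
    next
      assume e: "e (L i) = - 1"
      have "- (u * x) - v * y = - w \<longleftrightarrow> u * x + v * y = w" for u v w x y :: 'a by (auto simp: algebra_simps)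
      then show ?thesis using h(1) e by (simp add: a_def b_def c_def has_equation_def)
    qed
  qed
  interpret oriented_lines n a b c L
  proof unfold_locales
    show "3 \<le> n" by (rule n)
    show "has_equation (L i) (a i) (b i) (c i)" if "i < n" for i using that by (rule eqn)
  qed
  have lf: "lf i p = e (L i) * (a' (L i) * fst p + b' (L i) * snd p - c' (L i))" for i p
    by (simp add: lf_def a_def b_def c_def algebra_simps)
  have P_reg: "P = reg {}"
    unfolding P reg_def lf by (auto simp: sg_def)
  have p0: "lf i (x0, y0) > 0" if "i < n" for i
    using xy that by (simp add: lf)
  have ne: "d i j \<noteq> 0" if "i < n" "j < n" "i \<noteq> j" for i j
  proof (rule d_nonzero)
    show "L i \<noteq> L j" using inj that by (auto simp: inj_on_def)
    then show "L i \<inter> L j \<noteq> {}" using arr that by (auto simp: line_arrangement_def)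
  qed (use that in auto)
  interpret simple_oriented_lines n a b c L
    by unfold_locales (rule ne)
  have no_three: False if "i < n" "j < n" "k < n" "i \<noteq> j" "i \<noteq> k" "j \<noteq> k"
    "lf i p = 0" "lf j p = 0" "lf k p = 0" for i j k p
  proof -
    have "L i \<noteq> L j" "L i \<noteq> L k" "L j \<noteq> L k" using inj that(1-6) by (auto simp: inj_on_def)
    moreover have "\<forall>l\<in>L ` {..<n}. \<forall>m\<in>L ` {..<n}. \<forall>k\<in>L ` {..<n}.
        l \<noteq> m \<and> l \<noteq> k \<and> m \<noteq> k \<longrightarrow> l \<inter> m \<inter> k = {}"
      using arr unfolding line_arrangement_def by (elim conjE)
    ultimately have "L i \<inter> L j \<inter> L k = {}"
      using that(1-3) by simp
    moreover have "p \<in> L i" "p \<in> L j" "p \<in> L k" using mem_L that by simp_all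
    ultimately show False by blast
  qed
  obtain v where "\<forall>i<n. v i \<noteq> v ((i + 1) mod n)
    \<and> L i \<inter> P = segment (v i) (v ((i + 1) mod n))
    \<and> (\<forall>p\<in>P. weakly_left_of (v i) (v ((i + 1) mod n)) p)"
    using gon unfolding gonality_def by (elim conjE exE)
  then have v: "\<And>i. i < n \<Longrightarrow> v i \<noteq> v ((i + 1) mod n)"
    "\<And>i. i < n \<Longrightarrow> L i \<inter> P = segment (v i) (v ((i + 1) mod n))"
    "\<And>i p. i < n \<Longrightarrow> p \<in> P \<Longrightarrow> weakly_left_of (v i) (v ((i + 1) mod n)) p"
    by simp_all
  have on: "v i \<in> L i \<inter> P" "v ((i + 1) mod n) \<in> L i \<inter> P" if "i < n" for i
    unfolding v(2)[OF that] segment_def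
    by (rule CollectI, rule exI[of _ 0], simp) (rule CollectI, rule exI[of _ 1], simp)
  have in_P: "lf k p \<ge> 0" if "p \<in> P" "k < n" for k p
    using that by (simp add: P_reg reg_def sg_def)
  have next_ne: "(i + 1) mod n \<noteq> i" if "i < n" for i
    using that n by (cases "i + 1 = n") auto
  have d_pos: "d i ((i + 1) mod n) > 0" if i: "i < n" for i
  proof -
    define j where "j = (i + 1) mod n"
    have j: "j < n" "j \<noteq> i" using next_ne[OF i] n by (simp_all add: j_def)
    have "d i j \<ge> 0"
    proof (rule d_nonneg_of_side[OF i])
      show "lf i (v i) = 0" "lf i (v j) = 0" "lf j (v j) = 0"
        using on[OF i] on[OF j(1)] mem_L i j(1) unfolding j_def by auto
      show "lf j (v i) \<ge> 0" using in_P on[OF i] j by auto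
      show "v i \<noteq> v j" using v(1)[OF i] by (simp add: j_def)
      have "(x0, y0) \<in> P" using p0 by (simp add: P_reg reg_def sg_def less_imp_le)
      then show "weakly_left_of (v i) (v j) (x0, y0)" using v(3)[OF i] by (simp add: j_def)
      show "lf i (x0, y0) > 0" using p0 i by blast
    qed
    moreover have "d i j \<noteq> 0" using ne[OF i j(1)] j(2) by simp
    ultimately show ?thesis by (simp add: j_def)
  qed
  have D_consecutive: "D i (i + 1) k > 0" if i: "i + 1 < n" and k: "k < n" "k \<noteq> i" "k \<noteq> i + 1" for i k
  proof -
    \<comment> \<open>Here the side on \<open>L i\<close> ends and the next one begins, so both
      forms vanish; the point lies in P, and no third line passes through it.\<close>
    let ?p = "v (i + 1)"
    have 0: "lf i ?p = 0" "lf (i + 1) ?p = 0" and "?p \<in> P"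
      using on(2)[of i] on(1)[of "i + 1"] mem_L i by auto
    have "lf k ?p \<noteq> 0" using no_three[of i "i + 1" k ?p] 0 i k by auto
    then have "lf k ?p > 0" using in_P[OF \<open>?p \<in> P\<close> k(1)] by simp
    moreover have "d i (i + 1) > 0" using d_pos[of i] i by simp
    ultimately have "d i (i + 1) * lf k ?p > 0" by simp
    then show ?thesis using d_times_lf[OF 0] by simp
  qed
  have "polygon_lines n a b c L"
  proof unfold_locales
    show "D i j k > 0" if "i < j" "j < k" "k < n" for i j k
      using D_pos_of_consecutive[OF D_consecutive] that by blast
    show "d i (i + 1) > 0" if "i + 1 < n" for i using d_pos[of i] that by simp
    show "d (n - 1) 0 > 0" using d_pos[of "n - 1"] n by simp
    show "inj_on L {..<n}" by (rule inj)
    have "realised {}" unfolding realised_def using p0 by (auto simp: sg_def)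
    then show "\<not> recedes {}" using bounded_reg bd P_reg by simp
  qed
  then show thesis using that P_reg by blast
qed

theorem theorem5p6:
  fixes n k :: nat
    and L :: "nat \<Rightarrow> ('a::linordered_field \<times> 'a) set"
    and P :: "('a \<times> 'a) set"
  assumes "n \<ge> 3"
    and "inj_on L {..<n}"
    and "line_arrangement (L ` {..<n})"
    and "gonality n L P"
    and "k = card {i. i < n \<and> separating_index n L i}"
  shows "gons (L ` {..<n}) n = {P}
    \<and> card (gons (L ` {..<n}) 3 - {P}) = k
    \<and> int (card (gons (L ` {..<n}) 4 - {P})) = int ((n - 1) choose 2) - int k - 1"
proof -
  obtain a b c where pl: "polygon_lines n a b c L" and P: "P = oriented_lines.reg n a b c {}"
    using polygon_lines_of_gonality assms(1-4) .
  interpret polygon_lines n a b c L by (rule pl)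
  have sides: "meets_in_side (L ` {..<n}) (L i) P" if "i < n" for i
    using assms(4) that by (simp add: gonality_def)
  have "L i \<inter> P \<noteq> {}" if i: "i < n" for i
  proof -
    obtain p q where "L i \<inter> P = segment p q"
      using sides[OF i] unfolding meets_in_side_def by blast
    moreover have "p \<in> segment p q" unfolding segment_iff by (rule exI[of _ 0]) simp
    ultimately show ?thesis by blast
  qed
  then have "{l \<in> L ` {..<n}. l \<inter> P \<noteq> {}} = L ` {..<n}" by blast
  moreover have "card (L ` {..<n}) = n" using card_image[OF assms(2)] by simp
  moreover have "P \<in> bounded_regions (L ` {..<n})" using assms(4) by (simp add: gonality_def)
  ultimately have "P \<in> gons (L ` {..<n}) n"
    unfolding gons_def using sides by auto
  then show ?thesis using gon_counts[OF assms(5)] unfolding P by blast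
qed

end
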